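(* Let $n\ge 2$, let $\Omega,T\subset\mathbb{R}^n$ be bounded domains, let $\beta>0$, and let $I:\Omega\to[0,\infty)$ and $L:T\to[0,\infty)$ be integrable functions with $\int_T L(p)\,dp=\int_\Omega I(x)\,dx$. Then there exist weak solutions of type A and there exist weak solutions of type B of the two-reflector problem with data $(\Omega,T,I,L,\beta)$. Furthermore, if $(z,w)$ and $(z',w')$ are two weak solutions of the same type (both of type A, or both of type B) with ray tracing maps $\tilde P$ and $\tilde P'$ respectively, then $$\tilde P(x)=\tilde P'(x)$$ for almost all $x\in \operatorname{supp}(I)\setminus\{x\in\Omega: I(x)=0\}$.
   Context: A domain is a nonempty open connected set; "almost all" refers to Lebesgue measure. Paraboloids: for $p,x\in\mathbb{R}^n$ and real numbers $w,z$, $$k_{p,w}(x)=\frac{\beta^2-|x-p|^2}{2\beta}+w,\qquad h_{x,z}(p)=\frac{|x-p|^2-\beta^2}{2\beta}+z .$$ A pair $(z,w)\in C(\bar\Omega)\times C(\bar T)$ is a two-reflector of type A if $z(x)=\sup_{p\in\bar T}k_{p,w(p)}(x)$ for all $x\in\bar\Omega$ and $w(p)=\inf_{x\in\bar\Omega}h_{x,z(x)}(p)$ for all $p\in\bar T$. It is a two-reflector of type B if $z(x)=\inf_{p\in\bar T}k_{p,w(p)}(x)$ for all $x\in\bar\Omega$ and $w(p)=\sup_{x\in\bar\Omega}h_{x,z(x)}(p)$ for all $p\in\bar T$. Ray tracing map: put $Q(x,p)=\langle x,p\rangle+\beta w(p)-\frac{|p|^2}{2}$ for $x\in\mathbb{R}^n$,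 $p\in\bar T$. For type A let $V^*(x)=\sup_{p\in\bar T}Q(x,p)$, $x\in\mathbb{R}^n$ (a convex function), and let $\tilde P(x)$ be the set of all $p\in\mathbb{R}^n$ with $V^*(y)\ge V^*(x)+\langle p,y-x\rangle$ for all $y\in\mathbb{R}^n$ (the subdifferential). For type B let $V^*(x)=\inf_{p\in\bar T}Q(x,p)$ (a concave function), and let $\tilde P(x)$ be the set of all $p$ with $V^*(y)\le V^*(x)+\langle p,y-x\rangle$ for all $y\in\mathbb{R}^n$. The set $\tilde P(x)$ is a single point for almost every $x$; at such $x$ it is identified with that point. Extend $I$ by $0$ to $\mathbb{R}^n$. For a Borel set $\tau\subseteq T$ put $\tilde P^{-1}(\tau)=\{x\in\mathbb{R}^n:\tilde P(x)\cap\tau\neq\emptyset\}$ (a Lebesgue measurable set). A two-reflector $(z,w)$ of type A (resp. B) is a weak solution of type A (resp. B) of the two-reflector problem with data $(\Omega,T,I,L,\beta)$ if (i) $\tilde P:\bar\Omega\to\bar T$ is onto, i.e. for every $p\in\bar T$ there is $x\in\bar\Omega$ with $p\in\tilde P(x)$, and (ii) $\int_{\tilde P^{-1}(\tau)}I(x)\,dx=\int_\tau L(p)\,dp$ for every Borel set $\tau\subseteq T$. *)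

theory Defs
  imports "HOL-Analysis.Analysis"
begin

definition domain :: "'a::topological_space set \<Rightarrow> bool" where
  "domain S \<longleftrightarrow> S \<noteq> {} \<and> open S \<and> connected S"

definition paraboloid_k :: "real \<Rightarrow> real^'n \<Rightarrow> real \<Rightarrow> real^'n \<Rightarrow> real" where
  "paraboloid_k \<beta> p w x = (\<beta>\<^sup>2 - (norm (x - p))\<^sup>2) / (2 * \<beta>) + w"

definition paraboloid_h :: "real \<Rightarrow> real^'n \<Rightarrow> real \<Rightarrow> real^'n \<Rightarrow> real" where
  "paraboloid_h \<beta> x z p = ((norm (x - p))\<^sup>2 - \<beta>\<^sup>2) / (2 * \<beta>) + z"

datatype reflector_type = TypeA | TypeB

(* z and w are total functions of which only the values on the closures of \<Omega> and T matter.
   They are continuous on these compact sets, so every supremum and infimum below is that of a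
   nonempty bounded set of reals. *)
fun two_reflector ::
  "reflector_type \<Rightarrow> (real^'n) set \<Rightarrow> (real^'n) set \<Rightarrow> real
     \<Rightarrow> (real^'n \<Rightarrow> real) \<Rightarrow> (real^'n \<Rightarrow> real) \<Rightarrow> bool" where
  "two_reflector TypeA \<Omega> T \<beta> z w \<longleftrightarrow>
     continuous_on (closure \<Omega>) z \<and> continuous_on (closure T) w \<and>
     (\<forall>x\<in>closure \<Omega>. z x = (SUP p\<in>closure T. paraboloid_k \<beta> p (w p) x)) \<and>
     (\<forall>p\<in>closure T. w p = (INF x\<in>closure \<Omega>. paraboloid_h \<beta> x (z x) p))"
| "two_reflector TypeB \<Omega> T \<beta> z w \<longleftrightarrow>
     continuous_on (closure \<Omega>) z \<and> continuous_on (closure T) w \<and>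
     (\<forall>x\<in>closure \<Omega>. z x = (INF p\<in>closure T. paraboloid_k \<beta> p (w p) x)) \<and>
     (\<forall>p\<in>closure T. w p = (SUP x\<in>closure \<Omega>. paraboloid_h \<beta> x (z x) p))"

definition Q :: "real \<Rightarrow> (real^'n \<Rightarrow> real) \<Rightarrow> real^'n \<Rightarrow> real^'n \<Rightarrow> real" where
  "Q \<beta> w x p = x \<bullet> p + \<beta> * w p - (norm p)\<^sup>2 / 2"

fun V_star ::
  "reflector_type \<Rightarrow> (real^'n) set \<Rightarrow> real \<Rightarrow> (real^'n \<Rightarrow> real) \<Rightarrow> real^'n \<Rightarrow> real" where
  "V_star TypeA T \<beta> w x = (SUP p\<in>closure T. Q \<beta> w x p)"
| "V_star TypeB T \<beta> w x = (INF p\<in>closure T. Q \<beta> w x p)"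

(* The ray tracing map is kept set-valued throughout: the subdifferential of the convex function
   V_star for type A, the superdifferential of the concave function V_star for type B. *)
fun ray_map ::
  "reflector_type \<Rightarrow> (real^'n) set \<Rightarrow> real \<Rightarrow> (real^'n \<Rightarrow> real) \<Rightarrow> real^'n \<Rightarrow> (real^'n) set" where
  "ray_map TypeA T \<beta> w x =
     {p. \<forall>y. V_star TypeA T \<beta> w y \<ge> V_star TypeA T \<beta> w x + p \<bullet> (y - x)}"
| "ray_map TypeB T \<beta> w x =
     {p. \<forall>y. V_star TypeB T \<beta> w y \<le> V_star TypeB T \<beta> w x + p \<bullet> (y - x)}"

definition ray_preimage ::
  "reflector_type \<Rightarrow> (real^'n) set \<Rightarrow> real \<Rightarrow> (real^'n \<Rightarrow> real) \<Rightarrow> (real^'n) set \<Rightarrow> (real^'n) set" where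
  "ray_preimage t T \<beta> w \<tau> = {x. ray_map t T \<beta> w x \<inter> \<tau> \<noteq> {}}"

definition extend_zero :: "'a set \<Rightarrow> ('a \<Rightarrow> real) \<Rightarrow> 'a \<Rightarrow> real" where
  "extend_zero S f x = (if x \<in> S then f x else 0)"

definition weak_solution ::
  "reflector_type \<Rightarrow> (real^'n) set \<Rightarrow> (real^'n) set \<Rightarrow> (real^'n \<Rightarrow> real) \<Rightarrow> (real^'n \<Rightarrow> real)
     \<Rightarrow> real \<Rightarrow> (real^'n \<Rightarrow> real) \<Rightarrow> (real^'n \<Rightarrow> real) \<Rightarrow> bool" where
  "weak_solution t \<Omega> T I L \<beta> z w \<longleftrightarrow>
     two_reflector t \<Omega> T \<beta> z w \<and>
     (\<forall>p\<in>closure T. \<exists>x\<in>closure \<Omega>. p \<in> ray_map t T \<beta> w x) \<and>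
     (\<forall>\<tau>. \<tau> \<in> sets borel \<and> \<tau> \<subseteq> T \<longrightarrow>
        set_lebesgue_integral lebesgue (ray_preimage t T \<beta> w \<tau>) (extend_zero \<Omega> I)
          = set_lebesgue_integral lebesgue \<tau> L)"

(* Support of an integrable function: the complement of the largest open set on which the function
   vanishes almost everywhere. The closure of the set of points where f is nonzero would not do
   for the uniqueness claim: it depends on the values of f on null sets and, for f extended by zero
   from an open set whose boundary has positive measure, changing f on a countable dense set could
   add a non-null part of that boundary. Up to null sets, the support contains all points where
   f is nonzero. *)
definition supp :: "('a::euclidean_space \<Rightarrow> real) \<Rightarrow> 'a set" where
  "supp f = - \<Union>{U. open U \<and> (AE x in lebesgue. x \<in> U \<longrightarrow> f x = 0)}"

end

(*
  Completing the square turns a two-reflector into a pair of functions that are Legendre conjugates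
  of each other on the closures of Omega and T, and its ray tracing map into the subdifferential of
  one of them, so a weak solution is an optimal transport for the quadratic cost (Brenier).
  A minimizer phi of the dual functional (integral of the conjugate of phi against I, plus integral
  of phi against L) exists by Arzela-Ascoli, since taking the conjugate twice decreases the
  functional and produces equi-Lipschitz functions. Its first variation in the direction psi says
  that the integral of psi along the ray tracing map against I equals the integral of psi against L.
  Conversely a weak solution attains equality almost everywhere in Young's inequality, so two
  solutions share subgradients almost everywhere with respect to I. The subdifferentials have closed
  graphs, so they share one at every point of the support, and almost all of them are singletons.
*)
theory Submission
  imports Defs "HOL-Complex_Analysis.Great_Picard"
begin

section \<open>Legendre transforms over compact sets and subdifferentials\<close>

text \<open>Surjectivity of the ray tracing map cannot be read off from the balance of mass, because
  \<open>L\<close> may vanish on parts of \<open>T\<close>. It comes from conjugacy: when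
  \<open>legendre X (V \<phi>) p = \<phi> p\<close>, the supremum is attained at some
  \<open>x\<close> in \<open>X\<close>, and then \<open>p\<close> is a subgradient of
  \<open>V \<phi>\<close> at \<open>x\<close>. The minimizer is therefore sought among potentials
  that equal their biconjugate at every point of \<open>Y\<close>, and this property has to survive
  the limit. The balance of mass, in contrast, calls for a single-valued map. As \<open>I\<close> is
  a density, the kinks of \<open>V \<phi>\<close> form a set that the light does not see. Any choice
  of a maximizer in the supremum thus serves as the map, and the balance becomes an equality between
  a push-forward and the target measure. The potential of a given weak solution is continuous on the
  closure of \<open>T\<close> and arbitrary elsewhere, so the comparison of two solutions works with
  potentials of this kind, whereas the minimization runs over potentials continuous on the whole
  space.\<close>

definition legendre :: "'a::euclidean_space set \<Rightarrow> ('a \<Rightarrow> real) \<Rightarrow> 'a \<Rightarrow> real" where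
  "legendre Y \<phi> x = (SUP p\<in>Y. x \<bullet> p - \<phi> p)"

definition subdiff :: "('a::euclidean_space \<Rightarrow> real) \<Rightarrow> 'a \<Rightarrow> 'a set" where
  "subdiff V x = {p. \<forall>y. V y \<ge> V x + p \<bullet> (y - x)}"

lemma legendre_attained:
  assumes "compact Y" "Y \<noteq> {}" "continuous_on Y \<phi>"
  obtains p where "p \<in> Y" "legendre Y \<phi> x = x \<bullet> p - \<phi> p"
    "\<And>q. q \<in> Y \<Longrightarrow> x \<bullet> q - \<phi> q \<le> x \<bullet> p - \<phi> p"
proof -
  have "continuous_on Y (\<lambda>p. x \<bullet> p - \<phi> p)"
    using assms by (intro continuous_intros)
  then obtain p where p: "p \<in> Y" "\<And>q. q \<in> Y \<Longrightarrow> x \<bullet> q - \<phi> q \<le> x \<bullet> p - \<phi> p"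
    using continuous_attains_sup[OF assms(1,2)] by meson
  moreover have "legendre Y \<phi> x = x \<bullet> p - \<phi> p"
    unfolding legendre_def using p by (intro cSup_eq_maximum) auto
  ultimately show thesis using that by blast
qed

lemma legendre_ge:
  assumes "compact Y" "continuous_on Y \<phi>" "p \<in> Y"
  shows "x \<bullet> p - \<phi> p \<le> legendre Y \<phi> x"
proof -
  have "Y \<noteq> {}" using assms(3) by auto
  then obtain q where "legendre Y \<phi> x = x \<bullet> q - \<phi> q"
      "\<And>p. p \<in> Y \<Longrightarrow> x \<bullet> p - \<phi> p \<le> x \<bullet> q - \<phi> q"
    using legendre_attained[OF assms(1) _ assms(2), of x] by metis
  then show ?thesis using assms(3) by simp
qed

lemma legendre_le:
  assumes "Y \<noteq> {}" "\<And>p. p \<in> Y \<Longrightarrow> x \<bullet> p - \<phi> p \<le> c"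
  shows "legendre Y \<phi> x \<le> c"
  unfolding legendre_def using assms by (intro cSUP_least)

lemma legendre_cong:
  "(\<And>p. p \<in> Y \<Longrightarrow> \<phi> p = \<phi>' p) \<Longrightarrow> legendre Y \<phi> = legendre Y \<phi>'"
  unfolding legendre_def by (intro ext SUP_cong) auto

text \<open>Order reversal and stability in one statement: \<open>c = 0\<close> compares the
  transforms of ordered potentials, and a small \<open>c\<close> carries uniform closeness of
  potentials over to their transforms.\<close>

lemma legendre_mono:
  assumes "compact Y" "Y \<noteq> {}" "continuous_on Y \<phi>" "\<And>p. p \<in> Y \<Longrightarrow> \<phi> p - c \<le> \<phi>' p"
  shows "legendre Y \<phi>' x \<le> legendre Y \<phi> x + c"
proof (rule legendre_le[OF assms(2)])
  fix p assume "p \<in> Y"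
  then show "x \<bullet> p - \<phi>' p \<le> legendre Y \<phi> x + c"
    using assms(4)[of p] legendre_ge[OF assms(1,3), of p x] by simp
qed

lemma legendre_add_const:
  assumes "compact K" "K \<noteq> {}" "continuous_on K \<phi>"
  shows "legendre K (\<lambda>p. \<phi> p + c) x = legendre K \<phi> x - c"
proof -
  have c: "continuous_on K (\<lambda>p. \<phi> p + c)" using assms by (intro continuous_intros)
  show ?thesis
    using legendre_mono[OF assms, of "- c" "\<lambda>p. \<phi> p + c" x] legendre_mono[OF assms(1,2) c, of "c" \<phi> x]
    by simp
qed

text \<open>The maximizing slope at one point competes at the other, and all slopes have norm at
  most \<open>R\<close>. The constant depends on the compact set alone and not on \<phi>, which
  later makes minimizing sequences equicontinuous.\<close>

lemma legendre_lipschitz: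
  assumes "compact Y" "Y \<noteq> {}" "continuous_on Y \<phi>" "\<And>p. p \<in> Y \<Longrightarrow> norm p \<le> R"
  shows "\<bar>legendre Y \<phi> x - legendre Y \<phi> y\<bar> \<le> R * norm (x - y)"
proof -
  have *: "legendre Y \<phi> x - legendre Y \<phi> y \<le> R * norm (x - y)" for x y
  proof -
    obtain p where p: "p \<in> Y" "legendre Y \<phi> x = x \<bullet> p - \<phi> p"
      using legendre_attained[OF assms(1-3)] by metis
    have "legendre Y \<phi> x - legendre Y \<phi> y \<le> (x - y) \<bullet> p"
      using legendre_ge[OF assms(1,3) p(1), of y] p(2) by (simp add: inner_diff_left)
    also have "\<dots> \<le> norm (x - y) * norm p" by (rule norm_cauchy_schwarz)
    also have "\<dots> \<le> R * norm (x - y)"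
      using mult_left_mono[OF assms(4)[OF p(1)], of "norm (x - y)"] by (simp add: mult.commute)
    finally show ?thesis .
  qed
  show ?thesis using *[of x y] *[of y x] by (simp add: norm_minus_commute abs_le_iff)
qed

lemma continuous_on_legendre:
  assumes "compact Y" "Y \<noteq> {}" "continuous_on Y \<phi>"
  shows "continuous_on S (legendre Y \<phi>)"
proof -
  obtain R where R: "\<And>p. p \<in> Y \<Longrightarrow> norm p \<le> R"
    using compact_imp_bounded[OF assms(1)] by (auto simp: bounded_iff)
  moreover have "R \<ge> 0" using R assms(2) by (meson all_not_in_conv norm_ge_zero order_trans)
  ultimately have "R-lipschitz_on S (legendre Y \<phi>)"
    using legendre_lipschitz[OF assms] by (intro lipschitz_onI) (auto simp: dist_norm)
  then show ?thesis by (rule lipschitz_on_continuous_on)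
qed

lemma legendre_biconjugate_le:
  assumes "compact X" "X \<noteq> {}" "compact Y" "continuous_on Y \<phi>" "p \<in> Y"
  shows "legendre X (legendre Y \<phi>) p \<le> \<phi> p"
proof (rule legendre_le[OF assms(2)])
  fix x assume "x \<in> X"
  show "p \<bullet> x - legendre Y \<phi> x \<le> \<phi> p"
    using legendre_ge[OF assms(3-5), of x] by (simp add: inner_commute)
qed

text \<open>One inequality is the biconjugate bound for \<open>legendre Y \<phi>\<close> with
  \<open>X\<close> and \<open>Y\<close> exchanged, the other is order reversal applied to the
  biconjugate bound for \<phi>. The identity is confined to \<open>X\<close> because the middle
  transform sees \<open>legendre Y \<phi>\<close> only there.\<close>

lemma legendre_triconjugate:
  assumes "compact X" "X \<noteq> {}" "compact Y" "Y \<noteq> {}" "continuous_on Y \<phi>" "x \<in> X"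
  shows "legendre Y (legendre X (legendre Y \<phi>)) x = legendre Y \<phi> x"
proof (rule antisym)
  have c: "continuous_on X (legendre Y \<phi>)" "continuous_on Y (legendre X (legendre Y \<phi>))"
    using assms by (auto intro!: continuous_on_legendre)
  show "legendre Y (legendre X (legendre Y \<phi>)) x \<le> legendre Y \<phi> x"
    by (rule legendre_biconjugate_le[OF assms(3,4,1) c(1) assms(6)])
  show "legendre Y \<phi> x \<le> legendre Y (legendre X (legendre Y \<phi>)) x"
    using legendre_mono[OF assms(3,4) c(2), of 0 \<phi>]
      legendre_biconjugate_le[OF assms(1-3,5)] by simp
qed

lemma legendre_subdiff:
  assumes "compact Y" "continuous_on Y \<phi>" "p \<in> Y" "legendre Y \<phi> x = x \<bullet> p - \<phi> p"
  shows "p \<in> subdiff (legendre Y \<phi>) x"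
  unfolding subdiff_def
proof (intro CollectI allI)
  fix y
  show "legendre Y \<phi> x + p \<bullet> (y - x) \<le> legendre Y \<phi> y"
    using legendre_ge[OF assms(1-3), of y] assms(4) by (simp add: inner_diff_right inner_commute)
qed

lemma subdiff_legendre_bounded:
  assumes "compact Y" "Y \<noteq> {}" "continuous_on Y \<phi>" "\<And>q. q \<in> Y \<Longrightarrow> norm q \<le> R"
    and p: "p \<in> subdiff (legendre Y \<phi>) x"
  shows "norm p \<le> R"
proof (cases "p = 0")
  case True
  then show ?thesis using assms(2,4) by (metis all_not_in_conv norm_ge_zero norm_zero order_trans)
next
  case False
  \<comment> \<open>The subgradient inequality is tested one step along \<open>p\<close>
    itself.\<close>
  have "p \<bullet> p \<le> legendre Y \<phi> (x + p) - legendre Y \<phi> x"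
    using p by (auto simp: subdiff_def dest: spec[of _ "x + p"])
  also have "\<dots> \<le> R * norm p"
    using legendre_lipschitz[OF assms(1-4), of "x + p" x] by simp
  finally show ?thesis using False
    by (simp add: power2_norm_eq_inner[symmetric] power2_eq_square)
qed

lemma subdiff_limit:
  assumes "continuous_on UNIV V" "\<And>k. p k \<in> subdiff V (x k)" "x \<longlonglongrightarrow> a" "p \<longlonglongrightarrow> b"
  shows "b \<in> subdiff V a"
  unfolding subdiff_def
proof (intro CollectI allI)
  fix y
  have "(\<lambda>k. V (x k)) \<longlonglongrightarrow> V a"
    using continuous_on_tendsto_compose[OF assms(1,3)] by simp
  then have "(\<lambda>k. V (x k) + p k \<bullet> (y - x k)) \<longlonglongrightarrow> V a + b \<bullet> (y - a)"
    using assms by (intro tendsto_intros)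
  then show "V a + b \<bullet> (y - a) \<le> V y"
    by (rule LIMSEQ_le_const2) (use assms(2) in \<open>auto simp: subdiff_def\<close>)
qed

lemma subdiff_limit_subseq:
  assumes Y: "compact Y" "Y \<noteq> {}" "continuous_on Y \<phi>"
    and p: "\<And>k. p k \<in> subdiff (legendre Y \<phi>) (x k)" and x: "x \<longlonglongrightarrow> a"
  obtains b r where "strict_mono r" "(p \<circ> r) \<longlonglongrightarrow> b" "b \<in> subdiff (legendre Y \<phi>) a"
proof -
  obtain R where R: "\<And>p. p \<in> Y \<Longrightarrow> norm p \<le> R"
    using compact_imp_bounded[OF Y(1)] by (auto simp: bounded_iff)
  have "bounded (range p)"
    using subdiff_legendre_bounded[OF Y R p] by (auto simp: bounded_iff)
  then obtain b r where r: "strict_mono (r :: nat \<Rightarrow> nat)" "(p \<circ> r) \<longlonglongrightarrow> b"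
    using bounded_imp_convergent_subsequence by metis
  have "b \<in> subdiff (legendre Y \<phi>) a"
  proof (rule subdiff_limit)
    show "continuous_on UNIV (legendre Y \<phi>)" by (rule continuous_on_legendre[OF Y])
    show "(p \<circ> r) k \<in> subdiff (legendre Y \<phi>) ((x \<circ> r) k)" for k using p by simp
    show "(x \<circ> r) \<longlonglongrightarrow> a" by (rule LIMSEQ_subseq_LIMSEQ[OF x r(1)])
  qed (rule r(2))
  with r show thesis by (rule that)
qed

text \<open>All measurability of the ray tracing map rests on this. Subgradients at convergent
  points are bounded, so a subsequence converges, its limit is a subgradient at the limit point, and
  it stays in \<open>F\<close>.\<close>

lemma closed_subdiff_preimage:
  assumes "compact Y" "Y \<noteq> {}" "continuous_on Y \<phi>" "closed F"
  shows "closed {x. subdiff (legendre Y \<phi>) x \<inter> F \<noteq> {}}"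
  unfolding closed_sequential_limits
proof (intro allI impI, elim conjE)
  fix x a
  assume "\<forall>n. x n \<in> {x. subdiff (legendre Y \<phi>) x \<inter> F \<noteq> {}}" and x: "x \<longlonglongrightarrow> a"
  then have "\<exists>p. \<forall>n. p n \<in> subdiff (legendre Y \<phi>) (x n) \<inter> F"
    by (intro choice) auto
  then obtain p where p: "\<And>n. p n \<in> subdiff (legendre Y \<phi>) (x n)" "\<And>n. p n \<in> F" by auto
  obtain b r where "strict_mono r" "(p \<circ> r) \<longlonglongrightarrow> b" "b \<in> subdiff (legendre Y \<phi>) a"
    using subdiff_limit_subseq[OF assms(1-3) p(1) x] .
  moreover from this have "b \<in> F"
    using closed_sequentially[OF assms(4), of "p \<circ> r"] p(2) by simp
  ultimately show "a \<in> {x. subdiff (legendre Y \<phi>) x \<inter> F \<noteq> {}}" by auto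
qed

section \<open>The kinks of a Legendre transform form a null set\<close>

lemma subdiff_monotone:
  assumes "p \<in> subdiff V x" "q \<in> subdiff V y"
  shows "0 \<le> (p - q) \<bullet> (x - y)"
proof -
  have "V x + p \<bullet> (y - x) \<le> V y" "V y + q \<bullet> (x - y) \<le> V x"
    using assms by (auto simp: subdiff_def)
  then show ?thesis by (simp add: algebra_simps inner_diff_left inner_diff_right)
qed

text \<open>The translates of K by the vectors e/(k+1) are disjoint, of equal measure, and stay in a bounded set.\<close>

lemma negligible_if_lines_meet_once:
  fixes K :: "'a::euclidean_space set"
  assumes "compact K" "norm e = 1" and line: "\<And>x t. x \<in> K \<Longrightarrow> x + t *\<^sub>R e \<in> K \<Longrightarrow> t = 0"
  shows "negligible K"
proof -
  define A where "A k = (+) (inverse (real (Suc k)) *\<^sub>R e) ` K" for k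
  have cA: "compact (A k)" for k unfolding A_def by (intro compact_translation assms)
  have disj: "disjoint_family A"
  proof (unfold disjoint_family_on_def, intro ballI impI)
    fix j k :: nat assume "j \<noteq> k"
    show "A j \<inter> A k = {}"
    proof (rule ccontr)
      assume "A j \<inter> A k \<noteq> {}"
      then obtain x y where xy: "x \<in> K" "y \<in> K"
        and "inverse (real (Suc j)) *\<^sub>R e + x = inverse (real (Suc k)) *\<^sub>R e + y"
        by (auto simp: A_def)
      then have y: "y = x + (inverse (real (Suc j)) - inverse (real (Suc k))) *\<^sub>R e"
        by (simp add: algebra_simps)
      have "inverse (real (Suc j)) - inverse (real (Suc k)) = 0"
        using line[OF xy(1), of "inverse (real (Suc j)) - inverse (real (Suc k))"] xy(2) y by metis
      then have "real (Suc j) = real (Suc k)" by (metis eq_iff_diff_eq_0 inverse_eq_iff_eq)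
      with \<open>j \<noteq> k\<close> show False by simp
    qed
  qed
  obtain B where B: "\<And>x. x \<in> K \<Longrightarrow> norm x \<le> B"
    using compact_imp_bounded[OF assms(1)] by (auto simp: bounded_iff)
  have "(\<Union>k. A k) \<subseteq> cball 0 (1 + B)"
  proof (safe, unfold A_def, safe)
    fix k y assume "y \<in> K"
    have "norm (inverse (real (Suc k)) *\<^sub>R e + y) \<le> norm (inverse (real (Suc k)) *\<^sub>R e) + norm y"
      by (rule norm_triangle_ineq)
    also have "norm (inverse (real (Suc k)) *\<^sub>R e) \<le> 1" using assms(2) by (simp add: field_simps)
    finally show "inverse (real (Suc k)) *\<^sub>R e + y \<in> cball 0 (1 + B)"
      using B[OF \<open>y \<in> K\<close>] by simp
  qed
  then have fin: "emeasure lborel (\<Union>k. A k) < \<infinity>"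
    using cA by (intro le_less_trans[OF emeasure_mono emeasure_compact_finite[of "cball 0 (1 + B)"]]) auto
  have em: "emeasure lborel (A k) = emeasure lborel K" for k
  proof -
    have "A k \<in> lmeasurable" "K \<in> lmeasurable"
      using cA assms(1) by (auto intro: lmeasurable_compact)
    moreover have "measure lebesgue (A k) = measure lebesgue K"
      unfolding A_def by (rule measure_translation)
    ultimately have "emeasure lebesgue (A k) = emeasure lebesgue K"
      by (metis emeasure_eq_measure2 fmeasurableD2 emeasure_eq_ennreal_measure top.not_eq_extremum)
    then show ?thesis using cA[of k] assms(1) by (simp add: borel_compact)
  qed
  have "(\<Sum>k. emeasure lborel (A k)) = emeasure lborel (\<Union>k. A k)"
    using cA by (intro suminf_emeasure disj) (auto intro!: borel_compact)
  with fin have "(\<Sum>k::nat. emeasure lborel K) < \<infinity>" unfolding em by simp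
  moreover have "(\<Sum>k::nat. emeasure lborel K) = \<infinity>" if "emeasure lborel K > 0"
    using that nn_integral_count_space_nat[of "\<lambda>_. emeasure lborel K", symmetric] by (simp add: ennreal_mult_top)
  ultimately have "emeasure lborel K = 0"
    by (metis less_irrefl not_gr_zero)
  then have "emeasure lebesgue K = 0" using assms(1) by (simp add: borel_compact)
  then show ?thesis
    using lmeasurable_compact[OF assms(1)] by (auto simp: negligible_iff_null_sets intro!: null_setsI)
qed

text \<open>For a finite convex function, which has a subgradient everywhere, these are exactly the
  points of non-differentiability.\<close>

definition nondiff :: "('a::euclidean_space \<Rightarrow> real) \<Rightarrow> 'a set" where
  "nondiff V = {x. \<exists>p\<in>subdiff V x. \<exists>q\<in>subdiff V x. p \<noteq> q}"

text \<open>This replaces Rademacher's theorem. If two subgradients at a point differ in some coordinate,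
  two rationals separate them there; the resulting sets are closed, and by monotonicity of the
  subdifferential each line in that coordinate direction meets them at most once.\<close>

lemma negligible_nondiff:
  fixes Y :: "'a::euclidean_space set"
  assumes Y: "compact Y" "Y \<noteq> {}" "continuous_on Y \<phi>"
  shows "negligible (nondiff (legendre Y \<phi>))"
proof -
  let ?D = "subdiff (legendre Y \<phi>)"
  define N where "N e r s = {x. ?D x \<inter> {p. p \<bullet> e \<le> r} \<noteq> {}} \<inter> {x. ?D x \<inter> {p. p \<bullet> e \<ge> s} \<noteq> {}}" for e r s
  have cl: "closed (N e r s)" for e r s
    unfolding N_def
    by (intro closed_Int closed_subdiff_preimage Y) (auto intro!: closed_Collect_le continuous_intros)
  have neg: "negligible (N e r s)" if e: "e \<in> Basis" and rs: "r < s" for e r s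
  \<comment> \<open>The translation argument applies to compact sets, so the closed set is cut by
    boxes.\<close>
  proof (subst negligible_on_intervals, intro allI)
    fix a b
    show "negligible (N e r s \<inter> cbox a b)"
    proof (rule negligible_if_lines_meet_once[where e=e])
      show "compact (N e r s \<inter> cbox a b)" using cl by (simp add: closed_Int_compact)
      show "norm e = 1" using e by simp
      have nt: "\<not> t > 0" if x: "x \<in> N e r s" "x + t *\<^sub>R e \<in> N e r s" for x t
      proof
        assume t: "t > 0"
        obtain p q where p: "p \<in> ?D x" "p \<bullet> e \<ge> s" and q: "q \<in> ?D (x + t *\<^sub>R e)" "q \<bullet> e \<le> r"
          using x by (auto simp: N_def)
        \<comment> \<open>Moving forward along \<open>e\<close>, the \<open>e\<close>-component of a
          subgradient cannot decrease, yet here it would fall from at least \<open>s\<close> to at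
          most \<open>r\<close>.\<close>
        have "0 \<le> (q - p) \<bullet> (t *\<^sub>R e)" using subdiff_monotone[OF q(1) p(1)] by simp
        then have "0 \<le> (q - p) \<bullet> e" using t by (simp add: zero_le_mult_iff)
        then show False using p q rs by (simp add: inner_diff_left)
      qed
      show "t = 0" if "x \<in> N e r s \<inter> cbox a b" "x + t *\<^sub>R e \<in> N e r s \<inter> cbox a b" for x t
        using nt[of x t] nt[of "x + t *\<^sub>R e" "- t"] that by simp
    qed
  qed
  have "nondiff (legendre Y \<phi>) \<subseteq> (\<Union>e\<in>Basis. \<Union>r\<in>\<rat>. \<Union>s\<in>\<rat> \<inter> {r<..}. N e r s)"
  proof
    fix x assume "x \<in> nondiff (legendre Y \<phi>)"
    then obtain p q where pq: "p \<in> ?D x" "q \<in> ?D x" "p \<noteq> q" by (auto simp: nondiff_def)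
    then obtain e where e: "e \<in> Basis" "p \<bullet> e \<noteq> q \<bullet> e" using euclidean_eq_iff by blast
    have *: "\<exists>r\<in>\<rat>. \<exists>s\<in>\<rat> \<inter> {r<..}. x \<in> N e r s" if l: "p \<bullet> e < q \<bullet> e" "p \<in> ?D x" "q \<in> ?D x" for p q
    proof -
      obtain r where r: "r \<in> \<rat>" "p \<bullet> e < r" "r < q \<bullet> e" using Rats_dense_in_real[OF l(1)] by blast
      obtain s where s: "s \<in> \<rat>" "r < s" "s < q \<bullet> e" using Rats_dense_in_real[OF r(3)] by blast
      have "p \<in> ?D x \<inter> {p. p \<bullet> e \<le> r}" "q \<in> ?D x \<inter> {p. p \<bullet> e \<ge> s}"
        using that r s by auto
      then have "x \<in> N e r s" unfolding N_def by blast
      with r s show ?thesis by auto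
    qed
    show "x \<in> (\<Union>e\<in>Basis. \<Union>r\<in>\<rat>. \<Union>s\<in>\<rat> \<inter> {r<..}. N e r s)"
      using *[of p q] *[of q p] pq e unfolding neq_iff by blast
  qed
  moreover have "negligible (\<Union>e\<in>Basis. \<Union>r\<in>\<rat>. \<Union>s\<in>\<rat> \<inter> {r<..}. N e r s)"
    unfolding negligible_iff_null_sets
    using neg by (intro null_sets_UN' countable_finite countable_rat countable_Int1)
      (auto simp: negligible_iff_null_sets)
  ultimately show ?thesis by (rule negligible_subset[rotated])
qed

section \<open>Selections of the subdifferential\<close>

text \<open>Every maximizer is a subgradient of the transform, so outside \<open>nondiff\<close>
  there is only one. The arbitrary choice matters on a null set only.\<close>

definition maximizer :: "'a::euclidean_space set \<Rightarrow> ('a \<Rightarrow> real) \<Rightarrow> 'a \<Rightarrow> 'a" where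
  "maximizer Y \<phi> x = (SOME p. p \<in> Y \<and> legendre Y \<phi> x = x \<bullet> p - \<phi> p)"

lemma maximizer:
  assumes "compact Y" "Y \<noteq> {}" "continuous_on Y \<phi>"
  shows "maximizer Y \<phi> x \<in> Y"
    and "legendre Y \<phi> x = x \<bullet> maximizer Y \<phi> x - \<phi> (maximizer Y \<phi> x)"
proof -
  have "\<exists>p. p \<in> Y \<and> legendre Y \<phi> x = x \<bullet> p - \<phi> p"
    using legendre_attained[OF assms] by metis
  from someI_ex[OF this] show "maximizer Y \<phi> x \<in> Y"
    "legendre Y \<phi> x = x \<bullet> maximizer Y \<phi> x - \<phi> (maximizer Y \<phi> x)"
    unfolding maximizer_def by auto
qed

lemma maximizer_subdiff:
  assumes "compact Y" "Y \<noteq> {}" "continuous_on Y \<phi>"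
  shows "maximizer Y \<phi> x \<in> subdiff (legendre Y \<phi>) x"
  using legendre_subdiff[OF assms(1,3) maximizer[OF assms]] .

lemma subdiff_eq_maximizer:
  assumes "compact Y" "Y \<noteq> {}" "continuous_on Y \<phi>" "x \<notin> nondiff (legendre Y \<phi>)"
  shows "subdiff (legendre Y \<phi>) x = {maximizer Y \<phi> x}"
  using maximizer_subdiff[OF assms(1-3), of x] assms(4) unfolding nondiff_def by blast

lemma lebesgue_sets_subset_negligible:
  "negligible N \<Longrightarrow> A \<subseteq> N \<Longrightarrow> A \<in> sets lebesgue"
  by (meson negligible_subset negligible_imp_sets)

text \<open>Off the kinks the preimage of an open set is the complement of a closed set. On the
  kinks the choice is arbitrary, and completeness of Lebesgue measure absorbs it; for this reason
  the claim is not about Borel sets.\<close>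

lemma maximizer_measurable:
  assumes "compact Y" "Y \<noteq> {}" "continuous_on Y \<phi>"
  shows "maximizer Y \<phi> \<in> borel_measurable lebesgue"
proof (rule borel_measurableI)
  fix U :: "'a set" assume "open U"
  let ?S = "maximizer Y \<phi>" and ?N = "nondiff (legendre Y \<phi>)"
  let ?C = "{x. subdiff (legendre Y \<phi>) x \<inter> - U \<noteq> {}}"
  have "closed ?C" using closed_subdiff_preimage[OF assms closed_Compl[OF \<open>open U\<close>]] .
  have "?S -` U = ((- ?C) - ?N) \<union> (?S -` U \<inter> ?N)"
    using subdiff_eq_maximizer[OF assms] by auto
  also have "\<dots> \<in> sets lebesgue"
  proof (intro sets.Un sets.Diff)
    show "- ?C \<in> sets lebesgue"
      using \<open>closed ?C\<close> by (simp add: borel_open)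
    show "?N \<in> sets lebesgue" "?S -` U \<inter> ?N \<in> sets lebesgue"
      using lebesgue_sets_subset_negligible[OF negligible_nondiff[OF assms]] by auto
  qed
  finally show "?S -` U \<inter> space lebesgue \<in> sets lebesgue" by simp
qed

lemma subdiff_preimage_measurable:
  assumes "compact Y" "Y \<noteq> {}" "continuous_on Y \<phi>" "B \<in> sets borel"
  shows "{x. subdiff (legendre Y \<phi>) x \<inter> B \<noteq> {}} \<in> sets lebesgue" (is "?P \<in> _")
proof -
  let ?S = "maximizer Y \<phi>" and ?N = "nondiff (legendre Y \<phi>)"
  have "?P = (?S -` B - ?N) \<union> (?P \<inter> ?N)"
    using subdiff_eq_maximizer[OF assms(1-3)] by auto
  also have "\<dots> \<in> sets lebesgue"
  proof (intro sets.Un sets.Diff)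
    show "?S -` B \<in> sets lebesgue"
      using measurable_sets[OF maximizer_measurable[OF assms(1-3)] assms(4)] by simp
    show "?N \<in> sets lebesgue" "?P \<inter> ?N \<in> sets lebesgue"
      using lebesgue_sets_subset_negligible[OF negligible_nondiff[OF assms(1-3)]] by auto
  qed
  finally show ?thesis .
qed

section \<open>Derivative of the Legendre transform with respect to the potential\<close>

lemma legendre_difference_quotient:
  fixes x :: "'a::euclidean_space"
  assumes Y: "compact Y" "Y \<noteq> {}" "continuous_on Y \<phi>" and \<psi>: "continuous_on Y \<psi>"
    and a: "a > 0"
  defines "p \<equiv> maximizer Y (\<lambda>p. \<phi> p + a * \<psi> p) x"
  defines "D \<equiv> (legendre Y (\<lambda>p. \<phi> p + a * \<psi> p) x - legendre Y \<phi> x) / a"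
  shows "- \<psi> (maximizer Y \<phi> x) \<le> D" "D \<le> - \<psi> p"
proof -
  let ?\<phi> = "\<lambda>p. \<phi> p + a * \<psi> p" and ?s = "maximizer Y \<phi> x"
  have c: "continuous_on Y ?\<phi>" using Y \<psi> by (intro continuous_intros)
  \<comment> \<open>The maximizer of the unperturbed problem competes in the perturbed one, which
    yields the lower bound. The upper bound exchanges the roles.\<close>
  have "x \<bullet> ?s - ?\<phi> ?s \<le> legendre Y ?\<phi> x" "legendre Y \<phi> x = x \<bullet> ?s - \<phi> ?s"
    using legendre_ge[OF Y(1) c maximizer(1)[OF Y]] maximizer(2)[OF Y] by auto
  then have "- \<psi> ?s * a \<le> legendre Y ?\<phi> x - legendre Y \<phi> x" by (simp add: algebra_simps)
  then show "- \<psi> ?s \<le> D" unfolding D_def using a by (simp add: pos_le_divide_eq)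
  have "x \<bullet> p - \<phi> p \<le> legendre Y \<phi> x" "legendre Y ?\<phi> x = x \<bullet> p - ?\<phi> p"
    unfolding p_def using legendre_ge[OF Y(1,3) maximizer(1)[OF Y(1,2) c]] maximizer(2)[OF Y(1,2) c] by auto
  then have "legendre Y ?\<phi> x - legendre Y \<phi> x \<le> - \<psi> p * a" by (simp add: algebra_simps)
  then show "D \<le> - \<psi> p" unfolding D_def using a by (simp add: pos_divide_le_eq)
qed

text \<open>Outside a ball around the unique maximizer the values
  \<open>x \<bullet> p - \<phi> p\<close> stay below the maximum by a fixed gap, while the
  perturbation alters the comparison of two points by at most \<open>a k * (2 * B)\<close>.\<close>

lemma maximizer_perturbation_tendsto:
  assumes Y: "compact Y" "Y \<noteq> {}" "continuous_on Y \<phi>" and \<psi>: "continuous_on Y \<psi>"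
    and x: "x \<notin> nondiff (legendre Y \<phi>)" and a: "a \<longlonglongrightarrow> 0" "\<And>k. a k > 0"
  shows "(\<lambda>k::nat. maximizer Y (\<lambda>p. \<phi> p + a k * \<psi> p) x) \<longlonglongrightarrow> maximizer Y \<phi> x"
proof (rule tendstoI)
  let ?s = "maximizer Y \<phi> x"
  let ?p = "\<lambda>k. maximizer Y (\<lambda>p. \<phi> p + a k * \<psi> p) x"
  fix d :: real assume d: "d > 0"
  obtain B where B: "\<And>p. p \<in> Y \<Longrightarrow> \<bar>\<psi> p\<bar> \<le> B"
    using compact_imp_bounded[OF compact_continuous_image[OF \<psi> Y(1)]] by (auto simp: bounded_iff)
  let ?Z = "Y - ball ?s d"
  have Z: "compact ?Z" using Y(1) by (simp add: compact_diff)
  have cZ: "continuous_on ?Z \<phi>" using Y(3) by (rule continuous_on_subset) auto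
  have ck: "continuous_on Y (\<lambda>p. \<phi> p + a k * \<psi> p)" for k using Y \<psi> by (intro continuous_intros)
  have pY: "?p k \<in> Y" for k using maximizer(1)[OF Y(1,2) ck] .
  show "\<forall>\<^sub>F k in sequentially. dist (?p k) ?s < d"
  proof (cases "?Z = {}")
    case True
    then have "dist (?p k) ?s < d" for k using pY[of k] by (auto simp: dist_commute)
    then show ?thesis by simp
  next
    case False
    obtain q where q: "q \<in> ?Z" "\<And>p. p \<in> ?Z \<Longrightarrow> x \<bullet> p - \<phi> p \<le> x \<bullet> q - \<phi> q"
      using legendre_attained[OF Z False cZ, of x] by metis
    let ?g = "legendre Y \<phi> x - (x \<bullet> q - \<phi> q)"
    have "?g \<ge> 0" using legendre_ge[OF Y(1,3)] q(1) by simp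
    \<comment> \<open>A vanishing gap would make \<open>q\<close> a second maximizer and hence a
      second subgradient at \<open>x\<close>.\<close>
    moreover have "?g \<noteq> 0"
      using legendre_subdiff[OF Y(1,3), of q x] q(1) subdiff_eq_maximizer[OF Y x] d by auto
    ultimately have g: "?g > 0" by simp
    have "(\<lambda>k. a k * (2 * B)) \<longlonglongrightarrow> 0 * (2 * B)" by (intro tendsto_intros a)
    then have "\<forall>\<^sub>F k in sequentially. a k * (2 * B) < ?g"
      using g by (intro order_tendstoD(2)[where y=0]) simp_all
    then show ?thesis
    proof eventually_elim
      fix k assume k: "a k * (2 * B) < ?g"
      have "\<psi> (?p k) - \<psi> ?s \<ge> - (2 * B)"
        using B[OF pY[of k]] B[OF maximizer(1)[OF Y, of x]] by linarith
      then have le: "a k * (\<psi> (?p k) - \<psi> ?s) \<ge> - (a k * (2 * B))"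
        using mult_left_mono[of "- (2 * B)" "\<psi> (?p k) - \<psi> ?s" "a k"] a(2)[of k] by simp
      have "x \<bullet> ?s - (\<phi> ?s + a k * \<psi> ?s) \<le> x \<bullet> ?p k - (\<phi> (?p k) + a k * \<psi> (?p k))"
        using legendre_ge[OF Y(1) ck[of k] maximizer(1)[OF Y, of x], of x] maximizer(2)[OF Y(1,2) ck, of k x] by simp
      then have "legendre Y \<phi> x + a k * (\<psi> (?p k) - \<psi> ?s) \<le> x \<bullet> ?p k - \<phi> (?p k)"
        using maximizer(2)[OF Y, of x] by (simp add: algebra_simps)
      then have "x \<bullet> q - \<phi> q < x \<bullet> ?p k - \<phi> (?p k)" using le k by linarith
      then have "?p k \<notin> ?Z" using q(2) by force
      then show "dist (?p k) ?s < d" using pY[of k] by (auto simp: dist_commute)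
    qed
  qed
qed

text \<open>Envelope principle: only the expression under the supremum is differentiated, at the
  maximizer. The quotient is squeezed between \<open>- \<psi>\<close> at the unperturbed and at the
  perturbed maximizer.\<close>

lemma legendre_difference_quotient_tendsto:
  assumes Y: "compact Y" "Y \<noteq> {}" "continuous_on Y \<phi>" and \<psi>: "continuous_on Y \<psi>"
    and x: "x \<notin> nondiff (legendre Y \<phi>)" and a: "a \<longlonglongrightarrow> 0" "\<And>k. a k > 0"
  shows "(\<lambda>k::nat. (legendre Y (\<lambda>p. \<phi> p + a k * \<psi> p) x - legendre Y \<phi> x) / a k)
           \<longlonglongrightarrow> - \<psi> (maximizer Y \<phi> x)"
proof (rule real_tendsto_sandwich[where f="\<lambda>_. - \<psi> (maximizer Y \<phi> x)"])
  let ?p = "\<lambda>k. maximizer Y (\<lambda>p. \<phi> p + a k * \<psi> p) x"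
  have ck: "continuous_on Y (\<lambda>p. \<phi> p + a k * \<psi> p)" for k using Y \<psi> by (intro continuous_intros)
  have "(\<lambda>k. \<psi> (?p k)) \<longlonglongrightarrow> \<psi> (maximizer Y \<phi> x)"
    using maximizer(1)[OF Y(1,2) ck]
    by (intro continuous_on_tendsto_compose[OF \<psi> maximizer_perturbation_tendsto[OF assms]] maximizer(1)[OF Y]) auto
  then show "(\<lambda>k. - \<psi> (?p k)) \<longlonglongrightarrow> - \<psi> (maximizer Y \<phi> x)" by (intro tendsto_intros)
qed (use legendre_difference_quotient[OF Y \<psi> a(2)] in simp_all)

text \<open>Closed sets are an intersection-stable generator of the Borel sets, and the indicator of
  a closed set is the pointwise limit of continuous functions with values between 0 and 1.\<close>

lemma measure_eqI_continuous:
  fixes P N :: "'a::euclidean_space measure"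
  assumes "finite_measure P" "finite_measure N" "sets P = sets borel" "sets N = sets borel"
    and eq: "\<And>\<psi> :: 'a \<Rightarrow> real. continuous_on UNIV \<psi> \<Longrightarrow> (\<integral>x. \<psi> x \<partial>P) = (\<integral>x. \<psi> x \<partial>N)"
  shows "P = N"
proof (rule measure_eqI_generator_eq[where E="Collect closed" and \<Omega>=UNIV and A="\<lambda>_. UNIV"])
  interpret P: finite_measure P by fact
  interpret N: finite_measure N by fact
  show "sets P = sigma_sets UNIV (Collect closed)" "sets N = sigma_sets UNIV (Collect closed)"
    using assms(3,4) by (simp_all add: borel_eq_closed)
  show "emeasure P UNIV \<noteq> \<infinity>" by simp
  fix F :: "'a set" assume "F \<in> Collect closed"
  then have F: "closed F" by simp
  show "emeasure P F = emeasure N F"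
  \<comment> \<open>\<open>infdist\<close> to the empty set is 0 by convention, so the approximating
    functions would be constantly 1 there. The empty set is therefore treated apart.\<close>
  proof (cases "F = {}")
    case False
    define \<psi> where "\<psi> k x = max 0 (1 - real k * infdist x F)" for k :: nat and x :: 'a
    have c: "continuous_on UNIV (\<psi> k)" for k
      unfolding \<psi>_def by (intro continuous_intros)
    have lim: "(\<lambda>k. \<psi> k x) \<longlonglongrightarrow> indicator F x" for x
    proof (cases "x \<in> F")
      case True
      then show ?thesis by (simp add: \<psi>_def)
    next
      case x: False
      then have "infdist x F > 0"
        using F False by (metis in_closed_iff_infdist_zero infdist_nonneg less_eq_real_def)
      then obtain n :: nat where n: "1 < real n * infdist x F"
        using reals_Archimedean3 by blast
      have "\<psi> k x = 0" if "k \<ge> n" for k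
      proof -
        have "real n * infdist x F \<le> real k * infdist x F"
          using that by (intro mult_right_mono) (auto simp: infdist_nonneg)
        then show ?thesis using n by (simp add: \<psi>_def)
      qed
      then show ?thesis
        using x by (auto intro!: tendsto_eventually eventually_sequentiallyI[of n])
    qed
    have conv: "(\<lambda>k. \<integral>x. \<psi> k x \<partial>R) \<longlonglongrightarrow> measure R F"
      if R: "finite_measure R" "sets R = sets borel" for R
    proof -
      interpret R: finite_measure R by fact
      have m: "f \<in> borel_measurable R" if "continuous_on UNIV f" for f :: "'a \<Rightarrow> real"
        using borel_measurable_continuous_onI[OF that] measurable_cong_sets[OF R(2) refl] by blast
      have "(\<lambda>k. \<integral>x. \<psi> k x \<partial>R) \<longlonglongrightarrow> (\<integral>x. indicator F x \<partial>R)"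
      proof (rule integral_dominated_convergence[where w="\<lambda>_. 1"])
        show "indicator F \<in> borel_measurable R"
          using F R(2) by (intro borel_measurable_indicator) (simp add: borel_closed)
        show "AE x in R. norm (\<psi> k x) \<le> 1" for k
          by (simp add: \<psi>_def infdist_nonneg)
      qed (use m[OF c] lim in auto)
      then show ?thesis using R(2) sets_eq_imp_space_eq[OF R(2)] by simp
    qed
    have "measure P F = measure N F"
      using conv[OF assms(1,3)] conv[OF assms(2,4)] unfolding eq[OF c] by (rule LIMSEQ_unique)
    then show ?thesis by (simp add: P.emeasure_eq_measure N.emeasure_eq_measure)
  qed simp
qed (auto simp: Int_stable_def)

section \<open>Optimal transport for the quadratic cost\<close>

lemma bounded_on_compact:
  assumes "compact K" "continuous_on K (u :: 'a::topological_space \<Rightarrow> real)"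
  obtains B where "\<And>x. x \<in> K \<Longrightarrow> \<bar>u x\<bar> \<le> B"
  using compact_imp_bounded[OF compact_continuous_image[OF assms(2,1)]]
  by (auto simp: bounded_iff)

text \<open>\<open>M\<close> is the source and \<open>N\<close> the target, carried by the compact
  sets \<open>X\<close> and \<open>Y\<close>. \<open>M\<close> lives on the Lebesgue sets because
  \<open>maximizer\<close> is measurable with respect to them, and \<open>ac\<close> makes the null
  set of kinks invisible to it.\<close>

locale transport =
  fixes M N :: "'a::euclidean_space measure" and X Y :: "'a set"
  assumes fin_M: "finite_measure M" and fin_N: "finite_measure N"
    and sets_M: "sets M = sets lebesgue" and sets_N: "sets N = sets borel"
    and ac: "absolutely_continuous lebesgue M"
    and X: "compact X" "X \<noteq> {}" and Y: "compact Y" "Y \<noteq> {}"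
    and M_X: "AE x in M. x \<in> X" and N_Y: "AE p in N. p \<in> Y"
    and mass: "measure M UNIV = measure N UNIV"
begin

sublocale M: finite_measure M by (rule fin_M)
sublocale N: finite_measure N by (rule fin_N)

lemma space_M [simp]: "space M = UNIV" and space_N [simp]: "space N = UNIV"
  using sets_eq_imp_space_eq[OF sets_M] sets_eq_imp_space_eq[OF sets_N] by auto

lemma measurable_M: "u \<in> measurable lebesgue R \<Longrightarrow> u \<in> measurable M R"
  using measurable_cong_sets[OF sets_M refl] by blast

lemma measurable_N: "u \<in> measurable borel R \<Longrightarrow> u \<in> measurable N R"
  using measurable_cong_sets[OF sets_N refl] by blast

lemma continuous_measurable_M:
  "continuous_on UNIV (u :: 'a \<Rightarrow> 'b::topological_space) \<Longrightarrow> u \<in> borel_measurable M"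
  by (intro measurable_M measurable_completion) (simp add: borel_measurable_continuous_onI)

lemma continuous_measurable_N:
  "continuous_on UNIV (u :: 'a \<Rightarrow> 'b::topological_space) \<Longrightarrow> u \<in> borel_measurable N"
  by (intro measurable_N borel_measurable_continuous_onI)

lemma AE_M_negligible: "negligible A \<Longrightarrow> AE x in M. x \<notin> A"
  using ac by (intro AE_not_in) (auto simp: absolutely_continuous_def negligible_iff_null_sets)

lemma integrable_M:
  assumes "continuous_on UNIV (u :: 'a \<Rightarrow> real)"
  shows "integrable M u"
proof -
  obtain B where B: "\<And>x. x \<in> X \<Longrightarrow> \<bar>u x\<bar> \<le> B"
    using bounded_on_compact[OF X(1) continuous_on_subset[OF assms]] by auto
  show ?thesis
    using M_X B by (intro M.integrable_const_bound[where B=B] continuous_measurable_M assms) auto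
qed

lemma integrable_N:
  assumes "continuous_on UNIV (u :: 'a \<Rightarrow> real)"
  shows "integrable N u"
proof -
  obtain B where B: "\<And>x. x \<in> Y \<Longrightarrow> \<bar>u x\<bar> \<le> B"
    using bounded_on_compact[OF Y(1) continuous_on_subset[OF assms]] by auto
  show ?thesis
    using N_Y B by (intro N.integrable_const_bound[where B=B] continuous_measurable_N assms) auto
qed

section \<open>The dual problem and its minimizer\<close>

abbreviation V :: "('a \<Rightarrow> real) \<Rightarrow> 'a \<Rightarrow> real" where "V \<equiv> legendre Y"
abbreviation S :: "('a \<Rightarrow> real) \<Rightarrow> 'a \<Rightarrow> 'a" where "S \<equiv> maximizer Y"

text \<open>The dual Kantorovich functional.\<close>

definition J :: "('a \<Rightarrow> real) \<Rightarrow> real" where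
  "J \<phi> = (\<integral>x. V \<phi> x \<partial>M) + (\<integral>p. \<phi> p \<partial>N)"

lemma on_Y: "continuous_on UNIV \<phi> \<Longrightarrow> continuous_on Y \<phi>"
  by (rule continuous_on_subset) auto

lemma integrable_V: "continuous_on UNIV \<phi> \<Longrightarrow> integrable M (V \<phi>)"
  by (intro integrable_M continuous_on_legendre Y on_Y)

text \<open>Since the masses agree, the two errors add up. With \<open>a = - b\<close> a shift of
  the potential by a constant costs nothing; with \<open>a = b\<close> small, \<open>J\<close> is
  continuous under uniform convergence.\<close>

lemma J_le:
  assumes "continuous_on UNIV \<phi>" "continuous_on UNIV \<phi>'"
    "\<And>x. x \<in> X \<Longrightarrow> V \<phi>' x \<le> V \<phi> x + a" "\<And>p. p \<in> Y \<Longrightarrow> \<phi>' p \<le> \<phi> p + b"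
  shows "J \<phi>' \<le> J \<phi> + (a + b) * measure N UNIV"
proof -
  have "(\<integral>x. V \<phi>' x \<partial>M) \<le> (\<integral>x. V \<phi> x + a \<partial>M)"
    using M_X assms by (intro integral_mono_AE integrable_V Bochner_Integration.integrable_add) auto
  moreover have "(\<integral>x. \<phi>' x \<partial>N) \<le> (\<integral>x. \<phi> x + b \<partial>N)"
    using N_Y assms by (intro integral_mono_AE integrable_N Bochner_Integration.integrable_add) auto
  ultimately show ?thesis
    using assms(1,2) by (simp add: J_def integrable_V integrable_N mass algebra_simps)
qed

text \<open>The Lipschitz constant is the radius of \<open>X\<close>, because biconjugates are
  transforms over \<open>X\<close>. The value at \<open>p0\<close> removes the freedom of adding a
  constant, which \<open>J\<close> does not detect.\<close>

definition normalized :: "'a \<Rightarrow> ('a \<Rightarrow> real) \<Rightarrow> bool" where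
  "normalized p0 \<phi> \<longleftrightarrow> continuous_on UNIV \<phi> \<and> (\<forall>p q. \<bar>\<phi> p - \<phi> q\<bar> \<le> Sup (norm ` X) * norm (p - q)) \<and>
     \<phi> p0 = 0 \<and> (\<forall>p\<in>Y. legendre X (V \<phi>) p = \<phi> p)"

lemma norm_le_Sup: "x \<in> X \<Longrightarrow> norm x \<le> Sup (norm ` X)"
  using X(1) by (intro cSUP_upper) (auto intro!: bounded_imp_bdd_above compact_imp_bounded
    compact_continuous_image continuous_intros)

text \<open>The biconjugate of \<psi> lies below \<psi> on \<open>Y\<close> and has the same
  transform on \<open>X\<close>, so \<open>J\<close> does not increase. Subtracting its value at
  \<open>p0\<close> then changes the two integrals in \<open>J\<close> by opposite amounts.\<close>

lemma normalize:
  assumes \<psi>: "continuous_on UNIV \<psi>"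
  shows "\<exists>\<phi>. normalized p0 \<phi> \<and> J \<phi> \<le> J \<psi>"
proof -
  let ?\<chi> = "legendre X (V \<psi>)"
  let ?\<phi> = "\<lambda>p. ?\<chi> p + - ?\<chi> p0"
  have cV: "continuous_on K (V \<psi>)" for K by (intro continuous_on_legendre Y on_Y \<psi>)
  have c\<chi>: "continuous_on K ?\<chi>" for K by (intro continuous_on_legendre X cV)
  have c\<phi>: "continuous_on K ?\<phi>" for K by (intro continuous_intros c\<chi>)
  have tri: "V ?\<chi> x = V \<psi> x" if "x \<in> X" for x
    using legendre_triconjugate[OF X Y on_Y[OF \<psi>] that] .
  have V\<phi>: "V ?\<phi> x = V ?\<chi> x + ?\<chi> p0" for x
    using legendre_add_const[OF Y c\<chi>, of "- ?\<chi> p0"] by simp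
  have "legendre X (V ?\<phi>) p = ?\<phi> p" for p
  proof -
    have "legendre X (V ?\<phi>) p = legendre X (\<lambda>x. V \<psi> x + ?\<chi> p0) p"
      by (rule fun_cong[OF legendre_cong]) (simp only: V\<phi> tri)
    also have "\<dots> = ?\<phi> p" using legendre_add_const[OF X cV] by simp
    finally show ?thesis .
  qed
  then have "normalized p0 ?\<phi>"
    unfolding normalized_def using c\<phi> legendre_lipschitz[OF X cV norm_le_Sup] by simp
  moreover have "J ?\<phi> \<le> J \<psi> + (?\<chi> p0 + - ?\<chi> p0) * measure N UNIV"
  proof (rule J_le[OF \<psi> c\<phi>])
    show "V ?\<phi> x \<le> V \<psi> x + ?\<chi> p0" if "x \<in> X" for x
      using V\<phi>[of x] tri[OF that] by linarith
    show "?\<phi> p \<le> \<psi> p + - ?\<chi> p0" if "p \<in> Y" for p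
      using legendre_biconjugate_le[OF X Y(1) on_Y[OF \<psi>] that] by linarith
  qed
  ultimately show ?thesis by auto
qed

lemma J_bdd_below:
  assumes "p0 \<in> Y"
  obtains B where "\<And>\<phi>. normalized p0 \<phi> \<Longrightarrow> B \<le> J \<phi>"
proof -
  obtain R where R: "\<And>p. p \<in> Y \<Longrightarrow> norm p \<le> R" "R \<ge> 0"
    using compact_imp_bounded[OF Y(1)] by (metis bounded_pos less_imp_le)
  let ?L = "Sup (norm ` X)"
  have L: "?L \<ge> 0" using X(2) norm_le_Sup by (meson all_not_in_conv norm_ge_zero order_trans)
  \<comment> \<open>The competitor \<open>p0\<close>, at which \<phi> vanishes, bounds
    \<open>V \<phi>\<close> from below on \<open>X\<close> by \<open>- (?L * R)\<close>. On
    \<open>Y\<close>, at distance at most \<open>2 * R\<close> from \<open>p0\<close>, the Lipschitz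
    bound gives \<phi> at least \<open>- (?L * (2 * R))\<close>.\<close>
  have "- (?L * R + ?L * (2 * R)) * measure N UNIV \<le> J \<phi>" if n: "normalized p0 \<phi>" for \<phi>
  proof -
    have c: "continuous_on UNIV \<phi>" and p0: "\<phi> p0 = 0"
      using n by (auto simp: normalized_def)
    have 1: "- (?L * R) \<le> V \<phi> x" if "x \<in> X" for x
    proof -
      have "\<bar>x \<bullet> p0\<bar> \<le> norm x * norm p0" by (rule Cauchy_Schwarz_ineq2)
      also have "\<dots> \<le> ?L * R" using norm_le_Sup[OF that] R(1)[OF assms] L by (intro mult_mono) auto
      finally show ?thesis
        using legendre_ge[OF Y(1) on_Y[OF c] assms, of x] p0 by linarith
    qed
    have 2: "- (?L * (2 * R)) \<le> \<phi> p" if "p \<in> Y" for p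
    proof -
      have "\<bar>\<phi> p - \<phi> p0\<bar> \<le> ?L * norm (p - p0)" using n unfolding normalized_def by blast
      also have "norm (p - p0) \<le> 2 * R"
        using norm_triangle_ineq4[of p p0] R(1)[OF that] R(1)[OF assms] by simp
      finally show ?thesis using p0 L by (simp add: mult_left_mono)
    qed
    have "(\<integral>x. - (?L * R) \<partial>M) \<le> (\<integral>x. V \<phi> x \<partial>M)"
      using M_X 1 c by (intro integral_mono_AE integrable_V) auto
    moreover have "(\<integral>x. - (?L * (2 * R)) \<partial>N) \<le> (\<integral>x. \<phi> x \<partial>N)"
      using N_Y 2 c by (intro integral_mono_AE integrable_N) auto
    ultimately show ?thesis by (simp add: J_def mass algebra_simps)
  qed
  then show thesis by (rule that)
qed

lemma J_minimizer:
  obtains \<phi> where "continuous_on UNIV \<phi>" "\<And>p. p \<in> Y \<Longrightarrow> legendre X (V \<phi>) p = \<phi> p"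
    "\<And>\<psi>. continuous_on UNIV \<psi> \<Longrightarrow> J \<phi> \<le> J \<psi>"
proof -
  obtain p0 where p0: "p0 \<in> Y" using Y by auto
  let ?K = "{\<phi>. normalized p0 \<phi>}" and ?L = "Sup (norm ` X)"
  define I where "I = Inf (J ` ?K)"
  have ne: "?K \<noteq> {}" using normalize[of "\<lambda>_. 0" p0] by auto
  have bdd: "bdd_below (J ` ?K)" using J_bdd_below[OF p0] by (metis (no_types, lifting) bdd_belowI2 mem_Collect_eq)
  \<comment> \<open>The infimum over normalized potentials bounds \<open>J\<close> at every
    continuous potential, since normalizing does not increase \<open>J\<close>.\<close>
  have I: "I \<le> J \<psi>" if c: "continuous_on UNIV \<psi>" for \<psi>
  proof -
    obtain \<phi> where "normalized p0 \<phi>" "J \<phi> \<le> J \<psi>" using normalize[OF c] by blast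
    then show ?thesis using cINF_lower[OF bdd, of \<phi>] by (simp add: I_def)
  qed
  have "\<exists>\<phi>. normalized p0 \<phi> \<and> J \<phi> < I + inverse (real (Suc n))" for n
    using cInf_lessD[of "J ` ?K" "I + inverse (real (Suc n))"] ne unfolding I_def[symmetric] by auto
  then obtain f where f: "\<And>n. normalized p0 (f n)" "\<And>n. J (f n) < I + inverse (real (Suc n))"
    by metis
  have cf: "continuous_on UNIV (f n)" and lip: "\<bar>f n p - f n q\<bar> \<le> ?L * norm (p - q)"
    and f0: "f n p0 = 0" and bi: "p \<in> Y \<Longrightarrow> legendre X (V (f n)) p = f n p" for n p q
    using f(1)[of n] by (auto simp: normalized_def)
  have L: "?L \<ge> 0" using X(2) norm_le_Sup by (meson all_not_in_conv norm_ge_zero order_trans)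
  obtain R where R: "\<And>p. p \<in> Y \<Longrightarrow> norm p \<le> R"
    using compact_imp_bounded[OF Y(1)] by (auto simp: bounded_iff)
  obtain g k where g: "continuous_on Y g" "strict_mono (k :: nat \<Rightarrow> nat)"
    and unif: "\<And>e. 0 < e \<Longrightarrow> \<exists>N. \<forall>n x. n \<ge> N \<and> x \<in> Y \<longrightarrow> norm (f (k n) x - g x) < e"
  proof (rule Arzela_Ascoli[OF Y(1), where \<F>=f and M="?L * (2 * R)"])
    show "norm (f n p) \<le> ?L * (2 * R)" if "p \<in> Y" for n p
    proof -
      have "\<bar>f n p - f n p0\<bar> \<le> ?L * norm (p - p0)" by (rule lip)
      also have "\<dots> \<le> ?L * (2 * R)"
        using norm_triangle_ineq4[of p p0] R[OF that] R[OF p0] L by (intro mult_left_mono) auto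
      finally show ?thesis using f0 by simp
    qed
    show "\<exists>d>0. \<forall>n y. y \<in> Y \<and> norm (x - y) < d \<longrightarrow> norm (f n x - f n y) < e"
      if "0 < e" for x and e :: real
    \<comment> \<open>Adding 1 covers \<open>?L = 0\<close>, which occurs when \<open>X\<close>
      consists of the origin alone.\<close>
    proof (intro exI[of _ "e / (?L + 1)"] conjI allI impI)
      show "e / (?L + 1) > 0" using L that by simp
      fix n y assume "y \<in> Y \<and> norm (x - y) < e / (?L + 1)"
      then have "norm (x - y) * (?L + 1) < e" using L by (simp add: pos_less_divide_eq)
      moreover have "?L * norm (x - y) \<le> norm (x - y) * (?L + 1)" by (simp add: algebra_simps)
      ultimately show "norm (f n x - f n y) < e" using lip[of n x y] by simp
    qed
  qed blast
  \<comment> \<open>The uniform limit \<open>g\<close> is controlled on \<open>Y\<close> only. Its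
    biconjugate is continuous on the whole space and turns out to agree with \<open>g\<close> on
    \<open>Y\<close>.\<close>
  define \<phi> where "\<phi> = legendre X (V g)"
  have cV: "continuous_on A (V g)" for A by (intro continuous_on_legendre Y g)
  have c\<phi>: "continuous_on A \<phi>" for A unfolding \<phi>_def by (intro continuous_on_legendre X cV)
  have cVf: "continuous_on A (V (f n))" for A n by (intro continuous_on_legendre Y on_Y cf)
  have eq: "\<phi> p = g p" if p: "p \<in> Y" for p
  proof (rule antisym)
    show "\<phi> p \<le> g p" unfolding \<phi>_def using legendre_biconjugate_le[OF X Y(1) g(1) p] .
    \<comment> \<open>Each member of the sequence equals its biconjugate on \<open>Y\<close>.
      Replacing it by \<open>g\<close> costs half of the error on the left side and, through two
      transforms, half on the right side.\<close>
    show "g p \<le> \<phi> p"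
    proof (rule field_le_epsilon)
      fix e :: real assume "e > 0"
      then obtain n where n: "\<And>x. x \<in> Y \<Longrightarrow> \<bar>f n x - g x\<bar> < e / 2"
        using unif[of "e / 2"] by auto
      have "V g x \<le> V (f n) x + e / 2" for x
        using n by (intro legendre_mono Y on_Y cf) (smt (verit))
      then have "V (f n) x \<ge> V g x - e / 2" for x by (smt (verit))
      then have "legendre X (V (f n)) p \<le> legendre X (V g) p + e / 2"
        by (intro legendre_mono X cV) auto
      then show "g p \<le> \<phi> p + e" using bi[OF p, of n] n[OF p] unfolding \<phi>_def by linarith
    qed
  qed
  have V\<phi>: "V \<phi> = V g" using legendre_cong[of Y \<phi> g] eq by blast
  have min: "J \<phi> \<le> I"
  proof (rule field_le_epsilon)
    fix e :: real assume e: "e > 0"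
    let ?m = "measure N UNIV"
    \<comment> \<open>The comparison of potentials costs \<open>2 * d\<close> times the mass and the
      distance of \<open>J\<close> from its infimum costs one more \<open>d\<close>. The added 1
      also keeps the denominator positive when the mass is zero.\<close>
    define d where "d = e / (2 * ?m + 1)"
    have d: "d > 0" unfolding d_def using e by (intro divide_pos_pos) (auto intro: add_nonneg_pos)
    obtain n0 where n0: "\<And>n x. n \<ge> n0 \<Longrightarrow> x \<in> Y \<Longrightarrow> \<bar>f (k n) x - g x\<bar> < d"
      using unif[OF d] by auto
    obtain n1 where n1: "inverse (real (Suc n1)) < d" using reals_Archimedean[OF d] by blast
    let ?n = "max n0 n1"
    have "?n \<le> k ?n" by (rule seq_suble[OF g(2)])
    then have "inverse (real (Suc (k ?n))) \<le> inverse (real (Suc n1))"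
      by (intro le_imp_inverse_le) auto
    then have Jf: "J (f (k ?n)) < I + d" using f(2)[of "k ?n"] n1 by linarith
    have cl: "\<bar>f (k ?n) x - \<phi> x\<bar> \<le> d" if "x \<in> Y" for x
      using n0[OF _ that, of ?n] eq[OF that] by simp
    have "V \<phi> x \<le> V (f (k ?n)) x + d" for x
      using cl by (intro legendre_mono Y on_Y cf) (smt (verit))
    moreover have "\<phi> p \<le> f (k ?n) p + d" if "p \<in> Y" for p using cl[OF that] by linarith
    ultimately have "J \<phi> \<le> J (f (k ?n)) + (d + d) * ?m" by (intro J_le cf c\<phi>) auto
    also have "\<dots> \<le> I + d * (2 * ?m + 1)" using Jf by (simp add: algebra_simps)
    also have "d * (2 * ?m + 1) = e" unfolding d_def
      using measure_nonneg[of N UNIV] by (simp add: add_nonneg_pos[THEN less_imp_neq, symmetric])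
    finally show "J \<phi> \<le> I + e" .
  qed
  show thesis
  proof (rule that[OF c\<phi>])
    show "legendre X (V \<phi>) p = \<phi> p" if "p \<in> Y" for p unfolding V\<phi> by (simp add: \<phi>_def)
    show "J \<phi> \<le> J \<psi>" if "continuous_on UNIV \<psi>" for \<psi> using min I[OF that] by simp
  qed
qed

section \<open>First variation, push-forward and uniqueness of the transport map\<close>

lemma AE_M_diff: "continuous_on Y \<phi> \<Longrightarrow> AE x in M. x \<notin> nondiff (V \<phi>)"
  by (intro AE_M_negligible negligible_nondiff Y)

lemma measurable_S: "continuous_on Y \<phi> \<Longrightarrow> S \<phi> \<in> measurable M borel"
  by (intro measurable_M maximizer_measurable Y)

text \<open>Minimality makes \<open>(J (\<phi> + a * \<psi>) - J \<phi>) / a\<close> nonnegative for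
  \<open>a > 0\<close>, and \<open>a\<close> tends to 0. Positive \<open>a\<close> yields one
  inequality; the reverse one results from replacing \<psi> by its negative.\<close>

lemma first_variation:
  fixes \<psi> :: "'a \<Rightarrow> real"
  assumes c: "continuous_on UNIV \<phi>" and \<psi>: "continuous_on UNIV \<psi>"
    and min: "\<And>\<psi>. continuous_on UNIV \<psi> \<Longrightarrow> J \<phi> \<le> J \<psi>"
  shows "(\<integral>x. \<psi> (S \<phi> x) \<partial>M) \<le> (\<integral>p. \<psi> p \<partial>N)"
proof -
  define a where "a k = inverse (real (Suc k))" for k
  have a: "a k > 0" "a \<longlonglongrightarrow> 0" for k
    unfolding a_def using LIMSEQ_inverse_real_of_nat by auto
  let ?\<phi> = "\<lambda>k p. \<phi> p + a k * \<psi> p"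
  have ck: "continuous_on UNIV (?\<phi> k)" for k using c \<psi> by (intro continuous_intros)
  define D where "D k x = (V (?\<phi> k) x - V \<phi> x) / a k" for k x
  obtain B where B: "\<And>p. p \<in> Y \<Longrightarrow> \<bar>\<psi> p\<bar> \<le> B" using bounded_on_compact[OF Y(1) on_Y[OF \<psi>]] by blast
  have iD: "integrable M (D k)" for k
    unfolding D_def using ck c by (auto intro!: Bochner_Integration.integrable_diff integrable_V)
  \<comment> \<open>Both bounds of the difference quotient are values of \<open>- \<psi>\<close> at
    points of \<open>Y\<close>, so one constant dominates all quotients.\<close>
  have "\<bar>D k x\<bar> \<le> B" for k x
    using legendre_difference_quotient[OF Y on_Y[OF c] on_Y[OF \<psi>] a(1)[of k], of x]
      B[OF maximizer(1)[OF Y on_Y[OF c], of x]] B[OF maximizer(1)[OF Y on_Y[OF ck[of k]], of x]]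
    unfolding D_def by linarith
  then have lim: "(\<lambda>k. \<integral>x. D k x \<partial>M) \<longlonglongrightarrow> (\<integral>x. - \<psi> (S \<phi> x) \<partial>M)"
  proof (intro integral_dominated_convergence[where w="\<lambda>_. B"])
    show "(\<lambda>x. - \<psi> (S \<phi> x)) \<in> borel_measurable M"
      using measurable_compose[OF measurable_S[OF on_Y[OF c]] borel_measurable_continuous_onI[OF \<psi>]] by simp
    show "AE x in M. (\<lambda>k. D k x) \<longlonglongrightarrow> - \<psi> (S \<phi> x)"
      using AE_M_diff[OF on_Y[OF c]] unfolding D_def
      by eventually_elim (intro legendre_difference_quotient_tendsto Y on_Y c \<psi> a)
  qed (use iD in auto)
  have "0 \<le> (\<integral>x. D k x \<partial>M) + (\<integral>p. \<psi> p \<partial>N)" for k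
  proof -
    have "(\<integral>x. D k x \<partial>M) = ((\<integral>x. V (?\<phi> k) x \<partial>M) - (\<integral>x. V \<phi> x \<partial>M)) / a k"
      unfolding D_def using ck c by (simp add: integrable_V)
    moreover have "(\<integral>p. ?\<phi> k p \<partial>N) = (\<integral>p. \<phi> p \<partial>N) + a k * (\<integral>p. \<psi> p \<partial>N)"
      using c \<psi> by (simp add: integrable_N)
    ultimately have "a k * ((\<integral>x. D k x \<partial>M) + (\<integral>p. \<psi> p \<partial>N)) = J (?\<phi> k) - J \<phi>"
      using a(1)[of k] by (simp add: J_def field_simps)
    then have "0 \<le> a k * ((\<integral>x. D k x \<partial>M) + (\<integral>p. \<psi> p \<partial>N))" using min[OF ck, of k] by simp
    then show ?thesis using a(1)[of k] by (simp add: zero_le_mult_iff)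
  qed
  then have "0 \<le> (\<integral>x. - \<psi> (S \<phi> x) \<partial>M) + (\<integral>p. \<psi> p \<partial>N)"
    by (intro LIMSEQ_le_const[OF tendsto_add[OF lim tendsto_const]]) auto
  then show ?thesis by simp
qed

theorem exists_transport:
  obtains \<phi> where "continuous_on UNIV \<phi>" "\<And>p. p \<in> Y \<Longrightarrow> legendre X (V \<phi>) p = \<phi> p"
    "distr M borel (S \<phi>) = N"
proof -
  obtain \<phi> where \<phi>: "continuous_on UNIV \<phi>" "\<And>p. p \<in> Y \<Longrightarrow> legendre X (V \<phi>) p = \<phi> p"
    "\<And>\<psi>. continuous_on UNIV \<psi> \<Longrightarrow> J \<phi> \<le> J \<psi>" using J_minimizer by metis
  note mS = measurable_S[OF on_Y[OF \<phi>(1)]]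
  have "distr M borel (S \<phi>) = N"
  proof (rule measure_eqI_continuous)
    show "finite_measure (distr M borel (S \<phi>))" by (rule M.finite_measure_distr[OF mS])
    fix \<psi> :: "'a \<Rightarrow> real" assume \<psi>: "continuous_on UNIV \<psi>"
    have "(\<integral>x. \<psi> (S \<phi> x) \<partial>M) = (\<integral>p. \<psi> p \<partial>N)"
      using first_variation[OF \<phi>(1) \<psi> \<phi>(3)] first_variation[OF \<phi>(1) continuous_on_minus[OF \<psi>] \<phi>(3)]
      by simp
    then show "(\<integral>x. \<psi> x \<partial>distr M borel (S \<phi>)) = (\<integral>p. \<psi> p \<partial>N)"
      by (simp add: integral_distr[OF mS borel_measurable_continuous_onI[OF \<psi>]])
  qed (simp_all add: fin_N sets_N)
  with \<phi> show thesis using that by blast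
qed

text \<open>This links the set-valued preimage in the definition of weak solutions with the
  push-forward by the selection: the two preimages differ at kinks only.\<close>

lemma emeasure_subdiff_preimage:
  assumes c: "continuous_on Y \<phi>" and B: "B \<in> sets borel"
  shows "emeasure M {x. subdiff (V \<phi>) x \<inter> B \<noteq> {}} = emeasure (distr M borel (S \<phi>)) B"
proof -
  have "emeasure (distr M borel (S \<phi>)) B = emeasure M (S \<phi> -` B)"
    using emeasure_distr[OF measurable_S[OF c] B] by simp
  also have "\<dots> = emeasure M {x. subdiff (V \<phi>) x \<inter> B \<noteq> {}}"
  proof (rule emeasure_eq_AE)
    show "AE x in M. x \<in> S \<phi> -` B \<longleftrightarrow> x \<in> {x. subdiff (V \<phi>) x \<inter> B \<noteq> {}}"
      using AE_M_diff[OF c] by eventually_elim (simp add: subdiff_eq_maximizer[OF Y c])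
    show "S \<phi> -` B \<in> sets M" using measurable_sets[OF measurable_S[OF c] B] by simp
    show "{x. subdiff (V \<phi>) x \<inter> B \<noteq> {}} \<in> sets M"
      using subdiff_preimage_measurable[OF Y c B] by (simp add: sets_M)
  qed
  finally show ?thesis by simp
qed

text \<open>Weak solutions are tested on Borel subsets of \<open>T\<close> only. The test set
  \<open>T\<close> itself already receives the whole mass, so the push-forward has nothing left for
  the complement of \<open>T\<close>.\<close>

lemma distr_eqI:
  assumes c: "continuous_on Y \<phi>" and T: "T \<in> sets borel" and NT: "AE p in N. p \<in> T"
    and eq: "\<And>B. B \<in> sets borel \<Longrightarrow> B \<subseteq> T \<Longrightarrow>
        emeasure M {x. subdiff (V \<phi>) x \<inter> B \<noteq> {}} = emeasure N B"
  shows "distr M borel (S \<phi>) = N"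
proof (rule measure_eqI)
  let ?P = "distr M borel (S \<phi>)"
  interpret P: finite_measure ?P by (rule M.finite_measure_distr[OF measurable_S[OF c]])
  have eqT: "emeasure ?P B = emeasure N B" if "B \<in> sets borel" "B \<subseteq> T" for B
    using eq[OF that] emeasure_subdiff_preimage[OF c that(1)] by simp
  have "measure ?P T = measure N T" using eqT[OF T] by (simp add: measure_def)
  also have "\<dots> = measure N UNIV"
    using NT T sets_N by (intro N.finite_measure_eq_AE) auto
  also have "\<dots> = measure ?P UNIV"
    using measure_distr[OF measurable_S[OF c], of UNIV] mass by simp
  finally have "measure ?P (UNIV - T) = 0"
    using P.finite_measure_compl[of T] T by simp
  then have "emeasure ?P (UNIV - T) = 0" by (simp add: P.emeasure_eq_measure)
  then have PT: "AE p in ?P. p \<in> T"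
    using T by (intro AE_I[where N="UNIV - T"]) auto
  fix A assume "A \<in> sets ?P"
  then have A: "A \<in> sets borel" by simp
  have "emeasure ?P A = emeasure ?P (A \<inter> T)"
    using PT A T by (intro emeasure_eq_AE) auto
  also have "\<dots> = emeasure N (A \<inter> T)" using A T by (intro eqT) auto
  also have "\<dots> = emeasure N A"
    using NT A T sets_N by (intro emeasure_eq_AE) auto
  finally show "emeasure ?P A = emeasure N A" .
qed (simp add: sets_N)

text \<open>Both maps have the same transport cost, hence the nonnegative gap in the inequality
  of Young and Fenchel for one map and the other potential integrates to zero.\<close>

lemma maximizer_transports_optimal:
  assumes c: "continuous_on Y \<phi>" "continuous_on Y \<phi>'"
    and d: "distr M borel (S \<phi>) = N" "distr M borel (S \<phi>') = N"
  shows "AE x in M. S \<phi> x \<in> subdiff (V \<phi>') x"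
proof -
  \<comment> \<open>The potentials are continuous on \<open>Y\<close> and uncontrolled elsewhere.
    Cutting them off outside \<open>Y\<close> makes them Borel measurable without changing them
    along the maximizers, which stay in \<open>Y\<close>.\<close>
  define h where "h \<phi> p = indicat_real Y p * \<phi> p" for \<phi> :: "'a \<Rightarrow> real" and p
  have mh: "h \<phi> \<in> borel_measurable borel" if "continuous_on Y \<phi>" for \<phi>
    unfolding h_def using borel_measurable_continuous_on_indicator[OF _ that] Y(1)
    by (simp add: borel_compact)
  have hS: "h \<psi> (S \<phi> x) = \<psi> (S \<phi> x)" if "continuous_on Y \<phi>" for \<psi> \<phi> x
    unfolding h_def using maximizer(1)[OF Y that] by simp
  have ih: "integrable M (\<lambda>x. \<psi> (S \<phi> x))"
    and hN: "(\<integral>x. \<psi> (S \<phi> x) \<partial>M) = (\<integral>p. h \<psi> p \<partial>distr M borel (S \<phi>))"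
    if cc: "continuous_on Y \<phi>" "continuous_on Y \<psi>" for \<phi> \<psi>
  proof -
    obtain B where B: "\<And>p. p \<in> Y \<Longrightarrow> \<bar>\<psi> p\<bar> \<le> B" using bounded_on_compact[OF Y(1) cc(2)] by blast
    have "(\<lambda>x. h \<psi> (S \<phi> x)) \<in> borel_measurable M"
      by (rule measurable_compose[OF measurable_S[OF cc(1)] mh[OF cc(2)]])
    then show "integrable M (\<lambda>x. \<psi> (S \<phi> x))"
      unfolding hS[OF cc(1)] using B[OF maximizer(1)[OF Y cc(1)]]
      by (intro M.integrable_const_bound[where B=B]) auto
    show "(\<integral>x. \<psi> (S \<phi> x) \<partial>M) = (\<integral>p. h \<psi> p \<partial>distr M borel (S \<phi>))"
      using integral_distr[OF measurable_S[OF cc(1)] mh[OF cc(2)]] by (simp add: hS[OF cc(1)])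
  qed
  have iV: "integrable M (V \<phi>)" if "continuous_on Y \<phi>" for \<phi>
    by (intro integrable_M continuous_on_legendre Y that)
  have xS: "x \<bullet> S \<phi> x = V \<phi> x + \<phi> (S \<phi> x)" if "continuous_on Y \<phi>" for \<phi> x
    using maximizer(2)[OF Y that, of x] by simp
  define G where "G \<phi> \<phi>' x = V \<phi>' x + \<phi>' (S \<phi> x) - x \<bullet> S \<phi> x" for \<phi> \<phi>' :: "'a \<Rightarrow> real" and x
  have G0: "0 \<le> G \<phi> \<phi>' x" if "continuous_on Y \<phi>" "continuous_on Y \<phi>'" for \<phi> \<phi>' x
    using legendre_ge[OF Y(1) that(2) maximizer(1)[OF Y that(1), of x], of x] by (simp add: G_def)
  have iG: "integrable M (G \<phi> \<phi>')"
    and intG: "(\<integral>x. G \<phi> \<phi>' x \<partial>M) = (\<integral>x. V \<phi>' x \<partial>M) + (\<integral>p. h \<phi>' p \<partial>distr M borel (S \<phi>))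
      - ((\<integral>x. V \<phi> x \<partial>M) + (\<integral>p. h \<phi> p \<partial>distr M borel (S \<phi>)))"
    if "continuous_on Y \<phi>" "continuous_on Y \<phi>'" for \<phi> \<phi>'
    unfolding G_def xS[OF that(1)] hN[OF that(1,2), symmetric] hN[OF that(1,1), symmetric]
    using that by (simp_all add: iV ih)
  \<comment> \<open>With equal push-forwards, each gap integrates to a difference of the dual values
    of the two potentials, so exchanging the potentials changes the sign.\<close>
  have "(\<integral>x. G \<phi> \<phi>' x \<partial>M) = - (\<integral>x. G \<phi>' \<phi> x \<partial>M)"
    unfolding intG[OF c] intG[OF c(2,1)] d by simp
  moreover have "0 \<le> (\<integral>x. G \<phi> \<phi>' x \<partial>M)" "0 \<le> (\<integral>x. G \<phi>' \<phi> x \<partial>M)"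
    using G0 c by (auto intro!: integral_nonneg_AE)
  ultimately have "(\<integral>x. G \<phi> \<phi>' x \<partial>M) = 0" by simp
  then have "AE x in M. G \<phi> \<phi>' x = 0"
    using integral_nonneg_eq_0_iff_AE[OF iG[OF c]] G0[OF c] by simp
  then show ?thesis
  proof eventually_elim
    fix x assume "G \<phi> \<phi>' x = 0"
    then have "V \<phi>' x = x \<bullet> S \<phi> x - \<phi>' (S \<phi> x)" by (simp add: G_def)
    then show "S \<phi> x \<in> subdiff (V \<phi>') x"
      by (intro legendre_subdiff Y c maximizer(1))
  qed
qed

text \<open>The two maps are compared almost everywhere with respect to \<open>M\<close>, and a
  given \<open>x\<close> may belong to the exceptional set. The comparison is therefore made at
  points converging to \<open>x\<close>, and a common limit of subgradients settles it at
  \<open>x\<close>.\<close>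

theorem transport_unique:
  assumes c: "continuous_on Y \<phi>" "continuous_on Y \<phi>'"
    and d: "distr M borel (S \<phi>) = N" "distr M borel (S \<phi>') = N"
    and x: "x \<notin> nondiff (V \<phi>)" "x \<notin> nondiff (V \<phi>')"
    and supp: "\<And>U. open U \<Longrightarrow> x \<in> U \<Longrightarrow> \<not> (AE y in M. y \<notin> U)"
  shows "subdiff (V \<phi>) x = subdiff (V \<phi>') x"
proof -
  \<comment> \<open>If this failed, a whole ball around \<open>x\<close> would consist of
    exceptional points and have no mass, against \<open>supp\<close>.\<close>
  have "\<exists>y. dist y x < inverse (real (Suc n)) \<and> S \<phi> y \<in> subdiff (V \<phi>') y" for n
  proof (rule ccontr)
    assume "\<not> ?thesis"
    then have "AE y in M. y \<notin> ball x (inverse (real (Suc n)))"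
      using maximizer_transports_optimal[OF c d] by (auto simp: dist_commute elim!: eventually_mono)
    then show False using supp[of "ball x (inverse (real (Suc n)))"] by simp
  qed
  then obtain y where y: "\<And>n. dist (y n) x < inverse (real (Suc n))"
    "\<And>n. S \<phi> (y n) \<in> subdiff (V \<phi>') (y n)" by metis
  have lim: "y \<longlonglongrightarrow> x"
    by (rule metric_tendsto_imp_tendsto[OF LIMSEQ_inverse_real_of_nat])
      (use y(1) in \<open>auto intro!: always_eventually less_imp_le\<close>)
  obtain b r where b: "strict_mono r" "((\<lambda>n. S \<phi> (y n)) \<circ> r) \<longlonglongrightarrow> b" "b \<in> subdiff (V \<phi>') x"
    using subdiff_limit_subseq[OF Y c(2) y(2) lim] .
  have "b \<in> subdiff (V \<phi>) x"
  proof (rule subdiff_limit)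
    show "continuous_on UNIV (V \<phi>)" by (intro continuous_on_legendre Y c)
    show "((\<lambda>n. S \<phi> (y n)) \<circ> r) k \<in> subdiff (V \<phi>) ((y \<circ> r) k)" for k
      using maximizer_subdiff[OF Y c(1)] by simp
    show "(y \<circ> r) \<longlonglongrightarrow> x" by (rule LIMSEQ_subseq_LIMSEQ[OF lim b(1)])
  qed (rule b(2))
  with b(3) show ?thesis
    unfolding subdiff_eq_maximizer[OF Y c(1) x(1)] subdiff_eq_maximizer[OF Y c(2) x(2)] by simp
qed

end

section \<open>Two-reflectors\<close>

text \<open>Reflecting the source through the origin turns type B into type A: the function
  V*(x) = inf (Q x p) becomes -V*(-x) = sup (-Q (-x) p).\<close>

fun orient :: "reflector_type \<Rightarrow> real" where
  "orient TypeA = 1"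
| "orient TypeB = -1"

text \<open>Chosen so that \<open>orient t * Q \<beta> w x p\<close> equals the inner product of
  \<open>orient t *\<^sub>R x\<close> and \<open>p\<close> minus
  \<open>potential t \<beta> w p\<close>.\<close>

definition potential :: "reflector_type \<Rightarrow> real \<Rightarrow> (real^'n \<Rightarrow> real) \<Rightarrow> real^'n \<Rightarrow> real" where
  "potential t \<beta> w p = orient t * ((norm p)\<^sup>2 / 2 - \<beta> * w p)"

lemma orient_square [simp]: "orient t * orient t = 1" "orient t * (orient t * r) = r"
  by (cases t; simp)+

lemma orient_scaleR [simp]: "orient t *\<^sub>R (orient t *\<^sub>R x) = x" for x :: "'a::real_vector"
  by (cases t) simp_all

lemma orient_vimage: "(*\<^sub>R) (orient t) -` A = (*\<^sub>R) (orient t) ` A" for A :: "'a::real_vector set"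
  by (force simp: image_iff)

lemma negligible_orient_vimage:
  fixes A :: "'a::euclidean_space set"
  assumes "negligible A"
  shows "negligible ((*\<^sub>R) (orient t) -` A)"
  unfolding orient_vimage using assms
  by (intro negligible_differentiable_image_negligible) (auto intro!: derivative_intros)

lemma V_star_eq_legendre:
  "V_star t T \<beta> w x = orient t * legendre (closure T) (potential t \<beta> w) (orient t *\<^sub>R x)"
proof (cases t)
  case TypeA
  then show ?thesis by (simp add: legendre_def Q_def potential_def algebra_simps)
next
  case TypeB
  have "(INF p\<in>closure T. Q \<beta> w x p) = - (SUP p\<in>closure T. - Q \<beta> w x p)"
    by (simp add: Inf_real_def image_image)
  with TypeB show ?thesis by (simp add: legendre_def Q_def potential_def algebra_simps)
qed

text \<open>For type B both the function and its argument change sign. The two changes cancel in the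
  slope, so the supergradients become subgradients at the reflected point without any sign on
  \<open>p\<close>.\<close>

lemma ray_map_eq_subdiff:
  "ray_map t T \<beta> w x = subdiff (legendre (closure T) (potential t \<beta> w)) (orient t *\<^sub>R x)"
proof (cases t)
  case TypeA
  then show ?thesis using V_star_eq_legendre[of TypeA T \<beta> w] by (simp add: subdiff_def)
next
  case TypeB
  let ?V = "legendre (closure T) (potential t \<beta> w)"
  have V: "V_star TypeB T \<beta> w y = - ?V (- y)" for y
    using V_star_eq_legendre[of TypeB T \<beta> w y] TypeB by simp
  have "(\<forall>y. - ?V (- y) \<le> - ?V (- x) + p \<bullet> (y - x)) \<longleftrightarrow> (\<forall>y. ?V (- x) + p \<bullet> (y - - x) \<le> ?V y)" for p
  proof (intro iffI allI)
    fix y assume "\<forall>y. - ?V (- y) \<le> - ?V (- x) + p \<bullet> (y - x)"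
    from this[THEN spec, of "- y"] show "?V (- x) + p \<bullet> (y - - x) \<le> ?V y"
      by (simp add: inner_diff_right inner_add_right)
  next
    fix y assume "\<forall>y. ?V (- x) + p \<bullet> (y - - x) \<le> ?V y"
    from this[THEN spec, of "- y"] show "- ?V (- y) \<le> - ?V (- x) + p \<bullet> (y - x)"
      by (simp add: inner_diff_right inner_add_right)
  qed
  then show ?thesis unfolding TypeB ray_map.simps V subdiff_def by (simp add: TypeB)
qed

lemma norm_diff_power2: "(norm (x - p))\<^sup>2 = (norm x)\<^sup>2 - 2 * (x \<bullet> p) + (norm p)\<^sup>2"
  for x p :: "'a::real_inner"
  by (simp add: power2_norm_eq_inner inner_diff_left inner_diff_right inner_commute)

lemma paraboloid_k_eq:
  assumes "\<beta> > 0"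
  shows "paraboloid_k \<beta> p (w p) x =
    (orient t * (orient t *\<^sub>R x \<bullet> p - potential t \<beta> w p) + \<beta>\<^sup>2 / 2 - (norm x)\<^sup>2 / 2) / \<beta>"
proof -
  have "(b - (n - 2 * s + m)) / (2 * \<beta>) + v = (s - (m / 2 - \<beta> * v) + b / 2 - n / 2) / \<beta>"
    for b n s m v :: real
    using assms by (simp add: field_simps)
  note eq = this[of "\<beta>\<^sup>2" "(norm x)\<^sup>2" "x \<bullet> p" "(norm p)\<^sup>2" "w p"]
  have "orient t * (orient t *\<^sub>R x \<bullet> p - potential t \<beta> w p) = x \<bullet> p - ((norm p)\<^sup>2 / 2 - \<beta> * w p)"
    by (cases t) (simp_all add: potential_def)
  with eq show ?thesis
    by (simp only: paraboloid_k_def norm_diff_power2)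
qed

text \<open>The assumed form of \<open>z x\<close> is the completed square in which \<open>v\<close>
  stands for the transform at the reflected point. Its terms in \<open>\<beta>\<^sup>2\<close> and
  in the norm of \<open>x\<close> cancel against those of the paraboloid.\<close>

lemma paraboloid_h_eq:
  assumes "\<beta> > 0" and "z x = (orient t * v + \<beta>\<^sup>2 / 2 - (norm x)\<^sup>2 / 2) / \<beta>"
  shows "paraboloid_h \<beta> x (z x) p =
    ((norm p)\<^sup>2 / 2 - orient t * (p \<bullet> orient t *\<^sub>R x - v)) / \<beta>"
proof -
  have "(n - 2 * s + m - b) / (2 * \<beta>) + (v + b / 2 - n / 2) / \<beta> = (m / 2 - (s - v)) / \<beta>"
    for b n s m v :: real
    using assms(1) by (simp add: field_simps)
  note eq = this[of "(norm x)\<^sup>2" "x \<bullet> p" "(norm p)\<^sup>2" "\<beta>\<^sup>2" "orient t * v"]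
  have "orient t * (p \<bullet> orient t *\<^sub>R x - v) = x \<bullet> p - orient t * v"
    by (cases t) (simp_all add: inner_commute)
  with eq show ?thesis
    by (simp only: assms(2) paraboloid_h_def norm_diff_power2)
qed

text \<open>\<open>z\<close> and \<open>w\<close> are the completed squares solved for the reflector
  functions. The transforms enter \<open>z\<close> and \<open>w\<close> with the factor
  \<open>orient t\<close>, or its negative, divided by \<beta>, which is why maxima and minima trade
  places between the two types.\<close>

lemma conjugate_pair_two_reflector:
  fixes \<phi> :: "real^'n \<Rightarrow> real"
  assumes \<Omega>: "bounded \<Omega>" "\<Omega> \<noteq> {}" and T: "bounded T" "T \<noteq> {}" and "\<beta> > 0"
    and \<phi>: "continuous_on UNIV \<phi>"
    and conj: "\<And>p. p \<in> closure T \<Longrightarrow>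
        legendre ((*\<^sub>R) (orient t) ` closure \<Omega>) (legendre (closure T) \<phi>) p = \<phi> p"
  defines "z \<equiv> \<lambda>x. (orient t * legendre (closure T) \<phi> (orient t *\<^sub>R x) + \<beta>\<^sup>2 / 2 - (norm x)\<^sup>2 / 2) / \<beta>"
    and "w \<equiv> \<lambda>p. ((norm p)\<^sup>2 / 2 - orient t * \<phi> p) / \<beta>"
  shows "two_reflector t \<Omega> T \<beta> z w" "potential t \<beta> w = \<phi>"
    "\<forall>p\<in>closure T. \<exists>x\<in>closure \<Omega>. p \<in> ray_map t T \<beta> w x"
proof -
  let ?X = "(*\<^sub>R) (orient t) ` closure \<Omega>" and ?Y = "closure T" and ?V = "legendre (closure T) \<phi>"
  show pot: "potential t \<beta> w = \<phi>"
    using \<open>\<beta> > 0\<close> by (auto simp: potential_def w_def)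
  have Y: "compact ?Y" "?Y \<noteq> {}" and \<phi>Y: "continuous_on ?Y \<phi>"
    using T by (auto intro: continuous_on_subset[OF \<phi>])
  have cX: "compact (closure \<Omega>)" using \<Omega> by simp
  have X: "compact ?X" "?X \<noteq> {}"
    using \<Omega> by (auto intro: compact_scaling[OF cX])
  have cV: "continuous_on A ?V" for A by (intro continuous_on_legendre Y \<phi>Y)
  have cz: "continuous_on A z" for A
    unfolding z_def using \<open>\<beta> > 0\<close>
    by (intro continuous_intros continuous_on_compose2[OF cV[of UNIV]]) auto
  have cw: "continuous_on A w" for A
    unfolding w_def using \<open>\<beta> > 0\<close> continuous_on_subset[OF \<phi>, of A] by (intro continuous_intros) auto
  have k: "paraboloid_k \<beta> p (w p) x =
      (orient t * (orient t *\<^sub>R x \<bullet> p - \<phi> p) + \<beta>\<^sup>2 / 2 - (norm x)\<^sup>2 / 2) / \<beta>" for p x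
    using paraboloid_k_eq[OF \<open>\<beta> > 0\<close>, of p w x t] unfolding pot .
  have h: "paraboloid_h \<beta> x (z x) p =
      ((norm p)\<^sup>2 / 2 - orient t * (p \<bullet> orient t *\<^sub>R x - ?V (orient t *\<^sub>R x))) / \<beta>" for p x
    by (rule paraboloid_h_eq[OF \<open>\<beta> > 0\<close>]) (simp add: z_def)
  have ex_p: "\<exists>p\<in>?Y. z x = paraboloid_k \<beta> p (w p) x" for x
    using maximizer[OF Y \<phi>Y, of "orient t *\<^sub>R x"] unfolding k z_def by metis
  \<comment> \<open>The supremum in the second conjugate is attained in the reflected closure of
    \<Omega>. The point found here attains the extremum that defines \<open>w p\<close> and also
    shows, at the end, that the ray tracing map takes the value \<open>p\<close>.\<close>
  have ex_x: "\<exists>x\<in>closure \<Omega>. \<phi> p = p \<bullet> orient t *\<^sub>R x - ?V (orient t *\<^sub>R x)" if "p \<in> ?Y" for p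
  proof -
    let ?m = "maximizer ?X ?V p"
    have "?m \<in> ?X" by (rule maximizer(1)[OF X cV])
    then obtain x where x: "x \<in> closure \<Omega>" "?m = orient t *\<^sub>R x" by blast
    have "\<phi> p = p \<bullet> ?m - ?V ?m"
      using maximizer(2)[OF X cV, of p] conj[OF that] by simp
    with x show ?thesis by (intro bexI[of _ x]) simp_all
  qed
  have ex_x': "\<exists>x\<in>closure \<Omega>. w p = paraboloid_h \<beta> x (z x) p" if "p \<in> ?Y" for p
    using ex_x[OF that] unfolding h w_def by metis
  have k_le: "orient t *\<^sub>R x \<bullet> p - \<phi> p \<le> ?V (orient t *\<^sub>R x)" if "p \<in> ?Y" for p x
    by (rule legendre_ge[OF Y(1) \<phi>Y that])
  have h_le: "p \<bullet> orient t *\<^sub>R x - ?V (orient t *\<^sub>R x) \<le> \<phi> p" if "p \<in> ?Y" for p x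
    using k_le[OF that, of x] by (simp add: inner_commute)
  show "two_reflector t \<Omega> T \<beta> z w"
  proof (cases t)
    case TypeA
    have "z x = (SUP p\<in>?Y. paraboloid_k \<beta> p (w p) x)" for x
    proof (rule sym, rule cSup_eq_maximum)
      show "z x \<in> (\<lambda>p. paraboloid_k \<beta> p (w p) x) ` ?Y" using ex_p[of x] by auto
      show "y \<le> z x" if y: "y \<in> (\<lambda>p. paraboloid_k \<beta> p (w p) x) ` ?Y" for y
      proof -
        obtain p where "p \<in> ?Y" "y = paraboloid_k \<beta> p (w p) x" using y by blast
        then show ?thesis
          using k_le[of p x] \<open>\<beta> > 0\<close> unfolding k z_def TypeA by (auto intro!: divide_right_mono)
      qed
    qed
    moreover have "w p = (INF x\<in>closure \<Omega>. paraboloid_h \<beta> x (z x) p)" if p: "p \<in> ?Y" for p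
    proof (rule sym, rule cInf_eq_minimum)
      show "w p \<in> (\<lambda>x. paraboloid_h \<beta> x (z x) p) ` closure \<Omega>" using ex_x'[OF p] by auto
      show "w p \<le> y" if y: "y \<in> (\<lambda>x. paraboloid_h \<beta> x (z x) p) ` closure \<Omega>" for y
      proof -
        obtain x where "y = paraboloid_h \<beta> x (z x) p" using y by blast
        then show ?thesis
          using h_le[OF p, of x] \<open>\<beta> > 0\<close> unfolding h w_def TypeA by (auto intro!: divide_right_mono)
      qed
    qed
    ultimately show ?thesis unfolding TypeA two_reflector.simps using cz cw by blast
  next
    case TypeB
    have "z x = (INF p\<in>?Y. paraboloid_k \<beta> p (w p) x)" for x
    proof (rule sym, rule cInf_eq_minimum)
      show "z x \<in> (\<lambda>p. paraboloid_k \<beta> p (w p) x) ` ?Y" using ex_p[of x] by auto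
      show "z x \<le> y" if y: "y \<in> (\<lambda>p. paraboloid_k \<beta> p (w p) x) ` ?Y" for y
      proof -
        obtain p where "p \<in> ?Y" "y = paraboloid_k \<beta> p (w p) x" using y by blast
        then show ?thesis
          using k_le[of p x] \<open>\<beta> > 0\<close> unfolding k z_def TypeB by (auto intro!: divide_right_mono)
      qed
    qed
    moreover have "w p = (SUP x\<in>closure \<Omega>. paraboloid_h \<beta> x (z x) p)" if p: "p \<in> ?Y" for p
    proof (rule sym, rule cSup_eq_maximum)
      show "w p \<in> (\<lambda>x. paraboloid_h \<beta> x (z x) p) ` closure \<Omega>" using ex_x'[OF p] by auto
      show "y \<le> w p" if y: "y \<in> (\<lambda>x. paraboloid_h \<beta> x (z x) p) ` closure \<Omega>" for y
      proof -
        obtain x where "y = paraboloid_h \<beta> x (z x) p" using y by blast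
        then show ?thesis
          using h_le[OF p, of x] \<open>\<beta> > 0\<close> unfolding h w_def TypeB by (auto intro!: divide_right_mono)
      qed
    qed
    ultimately show ?thesis unfolding TypeB two_reflector.simps using cz cw by blast
  qed
  show "\<forall>p\<in>?Y. \<exists>x\<in>closure \<Omega>. p \<in> ray_map t T \<beta> w x"
  proof
    fix p assume p: "p \<in> ?Y"
    obtain x where x: "x \<in> closure \<Omega>" "\<phi> p = p \<bullet> orient t *\<^sub>R x - ?V (orient t *\<^sub>R x)"
      using ex_x[OF p] by blast
    have "p \<in> subdiff ?V (orient t *\<^sub>R x)"
      by (rule legendre_subdiff[OF Y(1) \<phi>Y p]) (use x(2) in \<open>simp add: inner_commute\<close>)
    then show "\<exists>x\<in>closure \<Omega>. p \<in> ray_map t T \<beta> w x"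
      using x(1) unfolding ray_map_eq_subdiff pot by blast
  qed
qed

section \<open>Light and target as measures\<close>

lemma emeasure_density_integral:
  assumes "integrable M f" "\<And>x. 0 \<le> f x" "A \<in> sets M"
  shows "emeasure (density M (\<lambda>x. ennreal (f x))) A = ennreal (set_lebesgue_integral M A f)"
proof -
  have "emeasure (density M (\<lambda>x. ennreal (f x))) A = (\<integral>\<^sup>+ x. ennreal (f x) * indicator A x \<partial>M)"
    using assms by (intro emeasure_density) auto
  also have "\<dots> = (\<integral>\<^sup>+ x. ennreal (indicator A x *\<^sub>R f x) \<partial>M)"
    by (intro nn_integral_cong) (auto simp: indicator_def)
  also have "\<dots> = ennreal (set_lebesgue_integral M A f)"
    unfolding set_lebesgue_integral_def
    using assms by (intro nn_integral_eq_integral integrable_mult_indicator) (auto simp: indicator_def)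
  finally show ?thesis .
qed

lemma extend_zero_integrable:
  "set_integrable M S f \<Longrightarrow> integrable M (extend_zero S f)"
proof -
  have "(\<lambda>x. indicator S x *\<^sub>R f x) = extend_zero S f"
    by (auto simp: extend_zero_def)
  then show "set_integrable M S f \<Longrightarrow> integrable M (extend_zero S f)"
    by (simp add: set_integrable_def)
qed

lemma set_integral_extend_zero:
  "B \<subseteq> S \<Longrightarrow> set_lebesgue_integral M B (extend_zero S f) = set_lebesgue_integral M B f"
  unfolding set_lebesgue_integral_def
  by (intro Bochner_Integration.integral_cong) (auto simp: extend_zero_def indicator_def)

lemma set_integral_extend_zero_UNIV:
  "set_lebesgue_integral M UNIV (extend_zero S f) = set_lebesgue_integral M S f"
  unfolding set_lebesgue_integral_def
  by (intro Bochner_Integration.integral_cong) (auto simp: extend_zero_def indicator_def)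

text \<open>The reflection of the source for type B is carried out on the measure. The Lebesgue sets
  are kept, as they are the ones for which the selection of the subdifferential is
  measurable.\<close>

definition light :: "reflector_type \<Rightarrow> (real^'n) set \<Rightarrow> (real^'n \<Rightarrow> real) \<Rightarrow> (real^'n) measure" where
  "light t \<Omega> I = distr (density lebesgue (\<lambda>x. ennreal (extend_zero \<Omega> I x))) lebesgue ((*\<^sub>R) (orient t))"

text \<open>The push-forward along the identity moves no mass. It restricts the measure to the Borel
  sets, so that it can equal a \<open>distr\<close> into \<open>borel\<close>.\<close>

definition target :: "(real^'n) set \<Rightarrow> (real^'n \<Rightarrow> real) \<Rightarrow> (real^'n) measure" where
  "target T L = distr (density lebesgue (\<lambda>x. ennreal (extend_zero T L x))) borel (\<lambda>x. x)"

lemma emeasure_light: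
  assumes I: "\<And>x. x \<in> \<Omega> \<Longrightarrow> I x \<ge> 0" "set_integrable lebesgue \<Omega> I" and A: "A \<in> sets lebesgue"
  shows "emeasure (light t \<Omega> I) A =
    ennreal (set_lebesgue_integral lebesgue ((*\<^sub>R) (orient t) -` A) (extend_zero \<Omega> I))"
proof -
  have m: "(*\<^sub>R) (orient t) -` A \<in> sets lebesgue"
    using measurable_sets[OF lebesgue_measurable_scaling A] by simp
  have "emeasure (light t \<Omega> I) A =
      emeasure (density lebesgue (\<lambda>x. ennreal (extend_zero \<Omega> I x))) ((*\<^sub>R) (orient t) -` A)"
    unfolding light_def using A by (subst emeasure_distr) auto
  also have "\<dots> = ennreal (set_lebesgue_integral lebesgue ((*\<^sub>R) (orient t) -` A) (extend_zero \<Omega> I))"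
    by (rule emeasure_density_integral[OF extend_zero_integrable[OF I(2)] _ m]) (simp add: extend_zero_def I(1))
  finally show ?thesis .
qed

lemma emeasure_target:
  assumes L: "\<And>p. p \<in> T \<Longrightarrow> L p \<ge> 0" "set_integrable lebesgue T L" and A: "A \<in> sets borel"
  shows "emeasure (target T L) A = ennreal (set_lebesgue_integral lebesgue A (extend_zero T L))"
proof -
  have m: "(\<lambda>x. x) \<in> measurable lebesgue borel" by (intro measurable_completion) simp
  have "A \<in> sets lebesgue" using A by simp
  have "emeasure (target T L) A = emeasure (density lebesgue (\<lambda>x. ennreal (extend_zero T L x))) A"
    unfolding target_def using A m by (subst emeasure_distr) auto
  also have "\<dots> = ennreal (set_lebesgue_integral lebesgue A (extend_zero T L))"
    by (rule emeasure_density_integral[OF extend_zero_integrable[OF L(2)] _ \<open>A \<in> sets lebesgue\<close>])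
      (simp add: extend_zero_def L(1))
  finally show ?thesis .
qed

lemma transport_light_target:
  fixes \<Omega> T :: "(real^'n) set"
  assumes \<Omega>: "bounded \<Omega>" "\<Omega> \<noteq> {}" and T: "bounded T" "T \<noteq> {}"
    and I: "\<And>x. x \<in> \<Omega> \<Longrightarrow> I x \<ge> 0" "set_integrable lebesgue \<Omega> I"
    and L: "\<And>p. p \<in> T \<Longrightarrow> L p \<ge> 0" "set_integrable lebesgue T L"
    and mass: "set_lebesgue_integral lebesgue T L = set_lebesgue_integral lebesgue \<Omega> I"
  shows "transport (light t \<Omega> I) (target T L) ((*\<^sub>R) (orient t) ` closure \<Omega>) (closure T)"
proof (rule transport.intro)
  note eI = emeasure_light[OF I] and eL = emeasure_target[OF L]
  show sM: "sets (light t \<Omega> I) = sets lebesgue" and sN: "sets (target T L) = sets borel"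
    by (simp_all add: light_def target_def)
  have sp: "space (light t \<Omega> I) = UNIV" "space (target T L) = UNIV"
    by (simp_all add: light_def target_def)
  show "finite_measure (light t \<Omega> I)" "finite_measure (target T L)"
    by (auto intro!: finite_measureI simp: sp eI eL)
  show "measure (light t \<Omega> I) UNIV = measure (target T L) UNIV"
    by (simp add: measure_def eI eL set_integral_extend_zero_UNIV mass)
  have cX: "compact (closure \<Omega>)" using \<Omega> by simp
  show "compact ((*\<^sub>R) (orient t) ` closure \<Omega>)" by (rule compact_scaling[OF cX])
  show "compact (closure T)" using T by simp
  show "(*\<^sub>R) (orient t) ` closure \<Omega> \<noteq> {}" "closure T \<noteq> {}" using \<Omega> T by auto
  show "absolutely_continuous lebesgue (light t \<Omega> I)"
    unfolding absolutely_continuous_def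
  proof
    fix A :: "(real^'n) set" assume A: "A \<in> null_sets lebesgue"
    then have "negligible ((*\<^sub>R) (orient t) -` A)"
      by (intro negligible_orient_vimage) (simp add: negligible_iff_null_sets)
    then have "AE x in lebesgue. x \<notin> (*\<^sub>R) (orient t) -` A"
      by (intro AE_not_in) (simp add: negligible_iff_null_sets)
    then have "set_lebesgue_integral lebesgue ((*\<^sub>R) (orient t) -` A) (extend_zero \<Omega> I) = 0"
      unfolding set_lebesgue_integral_def by (intro integral_eq_zero_AE) (auto simp: indicator_def)
    then have "emeasure (light t \<Omega> I) A = 0" by (simp add: eI[OF _ null_setsD2[OF A]])
    then show "A \<in> null_sets (light t \<Omega> I)" using A sM by auto
  qed
  have cl: "closed ((*\<^sub>R) (orient t) ` closure \<Omega>)" by (intro compact_imp_closed compact_scaling cX)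
  have mX: "- (*\<^sub>R) (orient t) ` closure \<Omega> \<in> sets lebesgue"
    using cl by (simp add: borel_open)
  have "set_lebesgue_integral lebesgue ((*\<^sub>R) (orient t) -` (- (*\<^sub>R) (orient t) ` closure \<Omega>)) (extend_zero \<Omega> I) = 0"
    unfolding set_lebesgue_integral_def using closure_subset[of \<Omega>]
    by (intro integral_eq_zero_AE) (auto simp: indicator_def extend_zero_def)
  then have "emeasure (light t \<Omega> I) (- (*\<^sub>R) (orient t) ` closure \<Omega>) = 0"
    by (simp add: eI[OF _ mX])
  then show "AE x in light t \<Omega> I. x \<in> (*\<^sub>R) (orient t) ` closure \<Omega>"
    using mX sM by (intro AE_I[where N="- (*\<^sub>R) (orient t) ` closure \<Omega>"]) auto
  have "set_lebesgue_integral lebesgue (- closure T) (extend_zero T L) = 0"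
    unfolding set_lebesgue_integral_def using closure_subset[of T]
    by (intro integral_eq_zero_AE) (auto simp: indicator_def extend_zero_def)
  then have "emeasure (target T L) (- closure T) = 0"
    by (subst eL) (auto intro: borel_open)
  then show "AE p in target T L. p \<in> closure T"
    using sN by (intro AE_I[where N="- closure T"]) (auto intro: borel_open)
qed

section \<open>Weak solutions as transport maps\<close>

lemma ray_preimage_eq:
  "ray_preimage t T \<beta> w \<tau> =
    (*\<^sub>R) (orient t) -` {x. subdiff (legendre (closure T) (potential t \<beta> w)) x \<inter> \<tau> \<noteq> {}}"
  unfolding ray_preimage_def ray_map_eq_subdiff by auto

lemma two_reflector_continuous: "two_reflector t \<Omega> T \<beta> z w \<Longrightarrow> continuous_on (closure T) w"
  by (cases t; hypsubst; unfold two_reflector.simps; elim conjE)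

lemma continuous_on_potential: "continuous_on S w \<Longrightarrow> continuous_on S (potential t \<beta> w)"
  unfolding potential_def by (auto intro!: continuous_intros)

text \<open>If \<open>U\<close> carried no light, \<open>I\<close> would vanish almost everywhere on
  the reflection of \<open>U\<close>, an open set containing \<open>x\<close>, against the
  definition of \<open>supp\<close>.\<close>

lemma supp_light:
  assumes "x \<in> supp (extend_zero \<Omega> I)" "open U" "orient t *\<^sub>R x \<in> U"
    and I: "\<And>x. x \<in> \<Omega> \<Longrightarrow> I x \<ge> 0" "set_integrable lebesgue \<Omega> I"
  shows "\<not> (AE y in light t \<Omega> I. y \<notin> U)"
proof
  assume "AE y in light t \<Omega> I. y \<notin> U"
  moreover have "{y \<in> space lebesgue. y \<notin> U} \<in> sets lebesgue"
    using assms(2) by (simp add: Compl_eq[symmetric] borel_closed)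
  ultimately have "AE y in density lebesgue (\<lambda>x. ennreal (extend_zero \<Omega> I x)). orient t *\<^sub>R y \<notin> U"
    unfolding light_def by (subst (asm) AE_distr_iff) auto
  moreover have "(\<lambda>x. ennreal (extend_zero \<Omega> I x)) \<in> borel_measurable lebesgue"
    using extend_zero_integrable[OF I(2)] by auto
  ultimately have "AE y in lebesgue. 0 < ennreal (extend_zero \<Omega> I y) \<longrightarrow> orient t *\<^sub>R y \<notin> U"
    by (subst (asm) AE_density) auto
  then have "AE y in lebesgue. y \<in> (*\<^sub>R) (orient t) -` U \<longrightarrow> extend_zero \<Omega> I y = 0"
    by eventually_elim (use I(1) in \<open>force simp: extend_zero_def\<close>)
  moreover have "open ((*\<^sub>R) (orient t) -` U)"
    by (intro open_vimage[OF assms(2)] continuous_intros)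
  moreover have "x \<in> (*\<^sub>R) (orient t) -` U" using assms(3) by simp
  ultimately show False using assms(1) unfolding supp_def by blast
qed

theorem theorem7p1:
  fixes \<Omega> T :: "(real^'n) set" and I L :: "real^'n \<Rightarrow> real" and \<beta> :: real
  assumes "CARD('n) \<ge> 2"
    and "domain \<Omega>" and "bounded \<Omega>"
    and "domain T" and "bounded T"
    and "\<beta> > 0"
    and "\<And>x. x \<in> \<Omega> \<Longrightarrow> I x \<ge> 0" and "set_integrable lebesgue \<Omega> I"
    and "\<And>p. p \<in> T \<Longrightarrow> L p \<ge> 0" and "set_integrable lebesgue T L"
    and "set_lebesgue_integral lebesgue T L = set_lebesgue_integral lebesgue \<Omega> I"
  shows "(\<exists>z w. weak_solution TypeA \<Omega> T I L \<beta> z w) \<and>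
         (\<exists>z w. weak_solution TypeB \<Omega> T I L \<beta> z w) \<and>
         (\<forall>t z w z' w'.
            weak_solution t \<Omega> T I L \<beta> z w \<and> weak_solution t \<Omega> T I L \<beta> z' w' \<longrightarrow>
            (AE x in lebesgue.
               x \<in> supp (extend_zero \<Omega> I) - {x \<in> \<Omega>. I x = 0} \<longrightarrow>
               ray_map t T \<beta> w x = ray_map t T \<beta> w' x))"
proof -
  note I = assms(7,8) and L = assms(9,10)
  have \<Omega>: "bounded \<Omega>" "\<Omega> \<noteq> {}" and T: "bounded T" "T \<noteq> {}" and oT: "open T"
    using assms(2-5) by (auto simp: domain_def)
  have tr: "transport (light t \<Omega> I) (target T L) ((*\<^sub>R) (orient t) ` closure \<Omega>) (closure T)" for t
    by (rule transport_light_target[OF \<Omega> T I L assms(11)])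
  have Y: "compact (closure T)" "closure T \<noteq> {}" using T by auto
  have nonneg: "0 \<le> set_lebesgue_integral lebesgue A (extend_zero \<Omega> I)"
    "0 \<le> set_lebesgue_integral lebesgue A (extend_zero T L)" for A
    unfolding set_lebesgue_integral_def using I(1) L(1)
    by (auto intro!: integral_nonneg_AE simp: extend_zero_def)
  \<comment> \<open>The balance of mass is restated as an equality of measures. Both integrals are
    nonnegative, so passing to extended nonnegative reals loses nothing.\<close>
  have pre: "(set_lebesgue_integral lebesgue (ray_preimage t T \<beta> w \<tau>) (extend_zero \<Omega> I)
        = set_lebesgue_integral lebesgue \<tau> L) \<longleftrightarrow>
      emeasure (light t \<Omega> I) {x. subdiff (legendre (closure T) (potential t \<beta> w)) x \<inter> \<tau> \<noteq> {}}
        = emeasure (target T L) \<tau>"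
    if "continuous_on (closure T) w" "\<tau> \<in> sets borel" "\<tau> \<subseteq> T" for t w \<tau>
  proof -
    let ?P = "{x. subdiff (legendre (closure T) (potential t \<beta> w)) x \<inter> \<tau> \<noteq> {}}"
    have "emeasure (light t \<Omega> I) ?P
        = ennreal (set_lebesgue_integral lebesgue (ray_preimage t T \<beta> w \<tau>) (extend_zero \<Omega> I))"
      unfolding ray_preimage_eq
      by (rule emeasure_light[OF I subdiff_preimage_measurable[OF Y continuous_on_potential[OF that(1)] that(2)]])
    moreover have "emeasure (target T L) \<tau> = ennreal (set_lebesgue_integral lebesgue \<tau> L)"
      using emeasure_target[OF L that(2)] by (simp add: set_integral_extend_zero[OF that(3)])
    ultimately show ?thesis
      using nonneg(1) nonneg(2)[of \<tau>] by (simp add: set_integral_extend_zero[OF that(3)])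
  qed
  have ex: "\<exists>z w. weak_solution t \<Omega> T I L \<beta> z w" for t
  proof -
    interpret transport "light t \<Omega> I" "target T L" "(*\<^sub>R) (orient t) ` closure \<Omega>" "closure T" by (rule tr)
    obtain \<phi> where \<phi>: "continuous_on UNIV \<phi>"
      and conj: "\<And>p. p \<in> closure T \<Longrightarrow>
        legendre ((*\<^sub>R) (orient t) ` closure \<Omega>) (legendre (closure T) \<phi>) p = \<phi> p"
      and d: "distr (light t \<Omega> I) borel (maximizer (closure T) \<phi>) = target T L"
      using exists_transport by metis
    obtain z w where cp: "two_reflector t \<Omega> T \<beta> z w" "potential t \<beta> w = \<phi>"
        "\<forall>p\<in>closure T. \<exists>x\<in>closure \<Omega>. p \<in> ray_map t T \<beta> w x"
      using conjugate_pair_two_reflector[OF \<Omega> T assms(6) \<phi> conj] by blast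
    have "set_lebesgue_integral lebesgue (ray_preimage t T \<beta> w \<tau>) (extend_zero \<Omega> I)
        = set_lebesgue_integral lebesgue \<tau> L" if \<tau>: "\<tau> \<in> sets borel" "\<tau> \<subseteq> T" for \<tau>
      unfolding pre[OF two_reflector_continuous[OF cp(1)] \<tau>] cp(2)
      using emeasure_subdiff_preimage[OF on_Y[OF \<phi>] \<tau>(1)] by (simp add: d)
    with cp show ?thesis unfolding weak_solution_def by blast
  qed
  have unique: "AE x in lebesgue. x \<in> supp (extend_zero \<Omega> I) \<longrightarrow> ray_map t T \<beta> w x = ray_map t T \<beta> w' x"
    if sol: "weak_solution t \<Omega> T I L \<beta> z w" "weak_solution t \<Omega> T I L \<beta> z' w'" for t z w z' w'
  proof -
    interpret transport "light t \<Omega> I" "target T L" "(*\<^sub>R) (orient t) ` closure \<Omega>" "closure T" by (rule tr)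
    \<comment> \<open>The boundary of \<open>T\<close> may have positive Lebesgue measure, but the
      density is extended by zero and gives it no mass.\<close>
    have "emeasure (target T L) (- T) = 0"
      using oT by (subst emeasure_target[OF L])
        (auto intro!: borel_closed integral_eq_zero_AE simp: set_lebesgue_integral_def indicator_def extend_zero_def)
    then have NT: "AE p in target T L. p \<in> T"
      using oT sets_N by (intro AE_I[where N="- T"]) (auto intro!: borel_closed)
    have w: "continuous_on (closure T) w" if "weak_solution t \<Omega> T I L \<beta> z w" for z w
      by (rule two_reflector_continuous[of t \<Omega> T \<beta> z]) (use that in \<open>simp add: weak_solution_def\<close>)
    have d: "distr (light t \<Omega> I) borel (maximizer (closure T) (potential t \<beta> w)) = target T L"
      if sol: "weak_solution t \<Omega> T I L \<beta> z w" for z w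
    proof (rule distr_eqI[OF continuous_on_potential[OF w[OF sol]] _ NT])
      show "T \<in> sets borel" using oT by simp
      show "emeasure (light t \<Omega> I) {x. subdiff (legendre (closure T) (potential t \<beta> w)) x \<inter> B \<noteq> {}}
          = emeasure (target T L) B" if "B \<in> sets borel" "B \<subseteq> T" for B
        using sol that unfolding pre[OF w[OF sol] that, symmetric] weak_solution_def by blast
    qed
    \<comment> \<open>The kinks are located in reflected coordinates, and reflection preserves null
      sets.\<close>
    have nd: "AE x in lebesgue. orient t *\<^sub>R x \<notin> nondiff (legendre (closure T) (potential t \<beta> w))"
      if sol: "weak_solution t \<Omega> T I L \<beta> z w" for z w
    proof -
      have "negligible ((*\<^sub>R) (orient t) -` nondiff (legendre (closure T) (potential t \<beta> w)))"
        by (intro negligible_orient_vimage negligible_nondiff Y continuous_on_potential w[OF sol])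
      then have "AE x in lebesgue. x \<notin> (*\<^sub>R) (orient t) -` nondiff (legendre (closure T) (potential t \<beta> w))"
        by (intro AE_not_in) (simp add: negligible_iff_null_sets)
      then show ?thesis by simp
    qed
    show ?thesis
      using nd[OF sol(1)] nd[OF sol(2)]
    proof eventually_elim
      case (elim x)
      show ?case
        unfolding ray_map_eq_subdiff
      proof
        assume x: "x \<in> supp (extend_zero \<Omega> I)"
        show "subdiff (legendre (closure T) (potential t \<beta> w)) (orient t *\<^sub>R x) =
            subdiff (legendre (closure T) (potential t \<beta> w')) (orient t *\<^sub>R x)"
          by (rule transport_unique[OF continuous_on_potential[OF w[OF sol(1)]]
              continuous_on_potential[OF w[OF sol(2)]] d[OF sol(1)] d[OF sol(2)] elim])
            (rule supp_light[OF x _ _ I])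
      qed
    qed
  qed
  show ?thesis
  proof (intro conjI ex allI impI, elim conjE)
    fix t z w z' w'
    assume sol: "weak_solution t \<Omega> T I L \<beta> z w" "weak_solution t \<Omega> T I L \<beta> z' w'"
    show "AE x in lebesgue. x \<in> supp (extend_zero \<Omega> I) - {x \<in> \<Omega>. I x = 0} \<longrightarrow>
        ray_map t T \<beta> w x = ray_map t T \<beta> w' x"
      using unique[OF sol] by eventually_elim blast
  qed
qed

end
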